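(* Let $\kappa$ be a field, $G$ a group and $\sigma\in pm(G)$ a factor set. If the spectral partial action $\hat\theta$ of $G$ on $\hat B^\sigma\cong\operatorname{Spec}B^\sigma$ is topologically free, then $\mathcal{I}\cap B^\sigma\neq0$ for each non-zero (two-sided) ideal $\mathcal{I}$ of $\kappa_{par}^\sigma G$.
   Context: Algebras are associative and unital, and homomorphisms preserve the unit. A partial projective $\sigma$-representation of $G$ in a unital $\kappa$-algebra $R$ (with $1_R\neq 0$) is a map $\Gamma:G\to R$ for which there is a function $\sigma:G\times G\to\kappa$ (called the factor set) such that for all $g,h\in G$: (i) if $\sigma(g,h)=0$ then $\Gamma(g^{-1})\Gamma(gh)=0$ and $\Gamma(gh)\Gamma(h^{-1})=0$; (ii) if $\Gamma(g)\Gamma(h)=0$ then $\sigma(g,h)=0$; (iii) $\Gamma(1_G)=1_R$; (iv) $\Gamma(g^{-1})\Gamma(g)\Gamma(h)=\sigma(g,h)\Gamma(g^{-1})\Gamma(gh)$; (v) $\Gamma(g)\Gamma(h)\Gamma(h^{-1})=\sigma(g,h)\Gamma(gh)\Gamma(h^{-1})$. The set of all factor sets of $G$ (over all such $R$ and $\Gamma$) is $pm(G)$. For $\sigma\in pm(G)$, the twisted partial group algebra $\kappa_{par}^{\sigma}G$ is the universal $\kappa$-algebra generated by symbols $[g]^\sigma$ ($g\in G$) subject to, for all $g,h\in G$: $\sigma(g,h)=0\Rightarrow [g^{-1}]^\sigma[gh]^\sigma=[gh]^\sigma[h^{-1}]^\sigma=0$; $[g^{-1}]^\sigma[g]^\sigma[h]^\sigma=\sigma(g,h)[g^{-1}]^\sigma[gh]^\sigma$;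 $[g]^\sigma[h]^\sigma[h^{-1}]^\sigma=\sigma(g,h)[gh]^\sigma[h^{-1}]^\sigma$; $[g]^\sigma[1_G]^\sigma=[1_G]^\sigma[g]^\sigma=[g]^\sigma$. Put $e_g^\sigma:=\sigma(g,g^{-1})^{-1}[g]^\sigma[g^{-1}]^\sigma$ if $\sigma(g,g^{-1})\neq0$ and $e_g^\sigma:=0$ otherwise. $B^\sigma$ is the (commutative) subalgebra of $\kappa_{par}^\sigma G$ generated by the idempotents $e_g^\sigma$, $g\in G$. There is a partial action $\theta^\sigma$ of $G$ on $B^\sigma$ by isomorphisms $\theta^\sigma_g:e_{g^{-1}}^\sigma B^\sigma\to e_g^\sigma B^\sigma$, $\theta^\sigma_g(w)=\sigma(g^{-1},g)^{-1}[g]^\sigma w[g^{-1}]^\sigma$ if $\sigma(g,g^{-1})\neq0$, and $\theta_g^\sigma=0$ (between zero ideals) otherwise. Let $\hat B^\sigma$ be the set of $\kappa$-algebra homomorphisms $f:B^\sigma\to\kappa$ with the topology of pointwise convergence ($\kappa$ discrete); $f\mapsto\ker f$ is a homeomorphism onto $\operatorname{Spec}B^\sigma$ with the Zariski topology. The spectral partial action $\hat\theta$ is given by $\hat D_g=\{f\in\hat B^\sigma:f(e_g^\sigma)=1\}$ and $\hat\theta_g:\hat D_{g^{-1}}\to\hat D_g$, $\hat\theta_g(f)(w)=f(\theta^\sigma_{g^{-1}}(e_g^\sigma w))$. A topological partial action $(\{X_g\},\{\theta_g:X_{g^{-1}}\to X_g\})$ of $G$ on a space $X$ is topologically free if for every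 $g\neq1_G$ the set $\{x\in X_{g^{-1}}:\theta_g(x)=x\}$ has empty interior. *)

theory Defs
  imports
    "HOL-Algebra.QuotRing"
    "HOL-Algebra.Subrings"
    "HOL-Library.Poly_Mapping"
    "HOL-Analysis.Function_Topology"
begin

section \<open>Associative unital algebras over a field\<close>

text \<open>
  The scalar field is a type of class \<^class>\<open>field\<close>; groups and algebras are objects with
  carriers.  HOL-Algebra's own algebra locale covers commutative algebras only.
\<close>

locale unital_algebra = ring A for A :: "('k::field, 'a) module" (structure) +
  assumes smult_closed: "x \<in> carrier A \<Longrightarrow> c \<odot> x \<in> carrier A"
    and smult_l_distr: "x \<in> carrier A \<Longrightarrow> (c + d) \<odot> x = (c \<odot> x) \<oplus> (d \<odot> x)"
    and smult_r_distr:
      "\<lbrakk>x \<in> carrier A; y \<in> carrier A\<rbrakk> \<Longrightarrow> c \<odot> (x \<oplus> y) = (c \<odot> x) \<oplus> (c \<odot> y)"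
    and smult_assoc: "x \<in> carrier A \<Longrightarrow> (c * d) \<odot> x = c \<odot> (d \<odot> x)"
    and smult_one: "x \<in> carrier A \<Longrightarrow> 1 \<odot> x = x"
    and smult_mult_left:
      "\<lbrakk>x \<in> carrier A; y \<in> carrier A\<rbrakk> \<Longrightarrow> (c \<odot> x) \<otimes> y = c \<odot> (x \<otimes> y)"
    and smult_mult_right:
      "\<lbrakk>x \<in> carrier A; y \<in> carrier A\<rbrakk> \<Longrightarrow> x \<otimes> (c \<odot> y) = c \<odot> (x \<otimes> y)"

definition unital_subalgebra :: "'a set \<Rightarrow> ('k, 'a) module \<Rightarrow> bool" where
  "unital_subalgebra B A \<longleftrightarrow> subring B A \<and> (\<forall>c. \<forall>x\<in>B. c \<odot>\<^bsub>A\<^esub> x \<in> B)"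

definition generated_subalgebra :: "('k, 'a) module \<Rightarrow> 'a set \<Rightarrow> 'a set" where
  "generated_subalgebra A S = \<Inter>{B. unital_subalgebra B A \<and> S \<subseteq> B}"

text \<open>
  HOL-Algebra's quotient ring by a two-sided ideal, with the induced scalar multiplication.
\<close>

definition quotient_algebra :: "('k, 'a) module \<Rightarrow> 'a set \<Rightarrow> ('k, 'a set) module" where
  "quotient_algebra A J =
    \<lparr>carrier = carrier (A Quot J), mult = mult (A Quot J), one = one (A Quot J),
     zero = zero (A Quot J), add = add (A Quot J),
     smult = (\<lambda>c X. \<Union>x\<in>X. J +>\<^bsub>A\<^esub> (c \<odot>\<^bsub>A\<^esub> x))\<rparr>"


section \<open>Partial projective representations and factor sets\<close>

definition has_factor_set ::
  "('g, 'm) monoid_scheme \<Rightarrow> ('k::field, 'r) module \<Rightarrow> ('g \<Rightarrow> 'r) \<Rightarrow> ('g \<Rightarrow> 'g \<Rightarrow> 'k) \<Rightarrow> bool"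
where
  "has_factor_set G R \<Gamma> \<sigma> \<longleftrightarrow>
     \<Gamma> \<in> carrier G \<rightarrow> carrier R \<and>
     \<Gamma> \<one>\<^bsub>G\<^esub> = \<one>\<^bsub>R\<^esub> \<and>
     (\<forall>g\<in>carrier G. \<forall>h\<in>carrier G.
        (\<sigma> g h = 0 \<longrightarrow>
           \<Gamma> (inv\<^bsub>G\<^esub> g) \<otimes>\<^bsub>R\<^esub> \<Gamma> (g \<otimes>\<^bsub>G\<^esub> h) = \<zero>\<^bsub>R\<^esub> \<and>
           \<Gamma> (g \<otimes>\<^bsub>G\<^esub> h) \<otimes>\<^bsub>R\<^esub> \<Gamma> (inv\<^bsub>G\<^esub> h) = \<zero>\<^bsub>R\<^esub>) \<and>
        (\<Gamma> g \<otimes>\<^bsub>R\<^esub> \<Gamma> h = \<zero>\<^bsub>R\<^esub> \<longrightarrow> \<sigma> g h = 0) \<and>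
        \<Gamma> (inv\<^bsub>G\<^esub> g) \<otimes>\<^bsub>R\<^esub> \<Gamma> g \<otimes>\<^bsub>R\<^esub> \<Gamma> h =
          \<sigma> g h \<odot>\<^bsub>R\<^esub> (\<Gamma> (inv\<^bsub>G\<^esub> g) \<otimes>\<^bsub>R\<^esub> \<Gamma> (g \<otimes>\<^bsub>G\<^esub> h)) \<and>
        \<Gamma> g \<otimes>\<^bsub>R\<^esub> \<Gamma> h \<otimes>\<^bsub>R\<^esub> \<Gamma> (inv\<^bsub>G\<^esub> h) =
          \<sigma> g h \<odot>\<^bsub>R\<^esub> (\<Gamma> (g \<otimes>\<^bsub>G\<^esub> h) \<otimes>\<^bsub>R\<^esub> \<Gamma> (inv\<^bsub>G\<^esub> h)))"

text \<open>
  HOL cannot quantify over the carrier type \<open>'r\<close> of the target algebra inside a definition, so it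
  is a parameter.  A hypothesis \<open>\<sigma> \<in> pm TYPE('r) G\<close> in which \<open>'r\<close> is a type variable not
  occurring elsewhere ranges over the target algebras on all types, i.e. over the whole set of
  factor sets.  Only the values of \<open>\<sigma>\<close> on the carrier of \<open>G\<close> matter.
\<close>

definition pm :: "'r itself \<Rightarrow> ('g, 'm) monoid_scheme \<Rightarrow> ('g \<Rightarrow> 'g \<Rightarrow> 'k::field) set" where
  "pm _ G = {\<sigma>. \<exists>(R :: ('k, 'r) module) \<Gamma>.
     unital_algebra R \<and> \<one>\<^bsub>R\<^esub> \<noteq> \<zero>\<^bsub>R\<^esub> \<and> has_factor_set G R \<Gamma> \<sigma>}"


section \<open>The twisted partial group algebra\<close>

text \<open>
  Words over \<open>G\<close> form a monoid under concatenation, so finitely supported functions on words with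
  the convolution product of \<^theory>\<open>HOL-Library.Poly_Mapping\<close> are noncommutative polynomials:
  the free unital algebra on the letters \<open>g \<in> G\<close>.
\<close>

instantiation list :: (type) monoid_add
begin

definition zero_list :: "'a list" where "zero_list = []"

definition plus_list :: "'a list \<Rightarrow> 'a list \<Rightarrow> 'a list" where "plus_list = (@)"

instance by standard (simp_all add: zero_list_def plus_list_def)

end

definition free_algebra ::
  "('g, 'm) monoid_scheme \<Rightarrow> ('k::field, 'g list \<Rightarrow>\<^sub>0 'k) module"
where
  "free_algebra G =
    \<lparr>carrier = {p. Poly_Mapping.keys p \<subseteq> lists (carrier G)},
     mult = (*), one = 1, zero = 0, add = (+),
     smult = (\<lambda>c. Poly_Mapping.map ((*) c))\<rparr>"

abbreviation letter :: "'g \<Rightarrow> 'g list \<Rightarrow>\<^sub>0 'k::field" where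
  "letter g \<equiv> Poly_Mapping.single [g] 1"

text \<open>
  The elements of the free algebra that are set to zero.  The relations
  \<open>[g][1] = [1][g] = [g]\<close> express that \<open>[1]\<close> is the unit of the twisted partial group algebra;
  in an algebra presented with a unit of its own they would only make it a unit for the
  generators, so \<open>[1]\<close> is in addition identified with that unit (the last set).
\<close>

definition twisted_relations ::
  "('g, 'm) monoid_scheme \<Rightarrow> ('g \<Rightarrow> 'g \<Rightarrow> 'k::field) \<Rightarrow> ('g list \<Rightarrow>\<^sub>0 'k) set"
where
  "twisted_relations G \<sigma> =
     {letter (inv\<^bsub>G\<^esub> g) * letter (g \<otimes>\<^bsub>G\<^esub> h) | g h.
        g \<in> carrier G \<and> h \<in> carrier G \<and> \<sigma> g h = 0} \<union>
     {letter (g \<otimes>\<^bsub>G\<^esub> h) * letter (inv\<^bsub>G\<^esub> h) | g h.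
        g \<in> carrier G \<and> h \<in> carrier G \<and> \<sigma> g h = 0} \<union>
     {letter (inv\<^bsub>G\<^esub> g) * letter g * letter h -
        \<sigma> g h \<odot>\<^bsub>free_algebra G\<^esub> (letter (inv\<^bsub>G\<^esub> g) * letter (g \<otimes>\<^bsub>G\<^esub> h)) | g h.
        g \<in> carrier G \<and> h \<in> carrier G} \<union>
     {letter g * letter h * letter (inv\<^bsub>G\<^esub> h) -
        \<sigma> g h \<odot>\<^bsub>free_algebra G\<^esub> (letter (g \<otimes>\<^bsub>G\<^esub> h) * letter (inv\<^bsub>G\<^esub> h)) | g h.
        g \<in> carrier G \<and> h \<in> carrier G} \<union>
     {letter g * letter \<one>\<^bsub>G\<^esub> - letter g | g. g \<in> carrier G} \<union>
     {letter \<one>\<^bsub>G\<^esub> * letter g - letter g | g. g \<in> carrier G} \<union>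
     {letter \<one>\<^bsub>G\<^esub> - 1}"

definition twisted_ideal ::
  "('g, 'm) monoid_scheme \<Rightarrow> ('g \<Rightarrow> 'g \<Rightarrow> 'k::field) \<Rightarrow> ('g list \<Rightarrow>\<^sub>0 'k) set"
where
  "twisted_ideal G \<sigma> = Idl\<^bsub>free_algebra G\<^esub> (twisted_relations G \<sigma>)"

definition twisted_par_algebra ::
  "('g, 'm) monoid_scheme \<Rightarrow> ('g \<Rightarrow> 'g \<Rightarrow> 'k::field) \<Rightarrow> ('k, ('g list \<Rightarrow>\<^sub>0 'k) set) module"
where
  "twisted_par_algebra G \<sigma> = quotient_algebra (free_algebra G) (twisted_ideal G \<sigma>)"

definition bracket ::
  "('g, 'm) monoid_scheme \<Rightarrow> ('g \<Rightarrow> 'g \<Rightarrow> 'k::field) \<Rightarrow> 'g \<Rightarrow> ('g list \<Rightarrow>\<^sub>0 'k) set"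
where
  "bracket G \<sigma> g = twisted_ideal G \<sigma> +>\<^bsub>free_algebra G\<^esub> letter g"

definition idem ::
  "('g, 'm) monoid_scheme \<Rightarrow> ('g \<Rightarrow> 'g \<Rightarrow> 'k::field) \<Rightarrow> 'g \<Rightarrow> ('g list \<Rightarrow>\<^sub>0 'k) set"
where
  "idem G \<sigma> g =
     (let A = twisted_par_algebra G \<sigma> in
      if \<sigma> g (inv\<^bsub>G\<^esub> g) \<noteq> 0
      then inverse (\<sigma> g (inv\<^bsub>G\<^esub> g)) \<odot>\<^bsub>A\<^esub> (bracket G \<sigma> g \<otimes>\<^bsub>A\<^esub> bracket G \<sigma> (inv\<^bsub>G\<^esub> g))
      else \<zero>\<^bsub>A\<^esub>)"

definition B_alg ::
  "('g, 'm) monoid_scheme \<Rightarrow> ('g \<Rightarrow> 'g \<Rightarrow> 'k::field) \<Rightarrow> ('g list \<Rightarrow>\<^sub>0 'k) set set"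
where
  "B_alg G \<sigma> = generated_subalgebra (twisted_par_algebra G \<sigma>) (idem G \<sigma> ` carrier G)"

text \<open>
  The formula of the partial action on \<^const>\<open>B_alg\<close>; it is meaningful on the ideal
  generated by \<open>idem G \<sigma> (inv g)\<close> only.
\<close>

definition theta ::
  "('g, 'm) monoid_scheme \<Rightarrow> ('g \<Rightarrow> 'g \<Rightarrow> 'k::field) \<Rightarrow> 'g \<Rightarrow>
   ('g list \<Rightarrow>\<^sub>0 'k) set \<Rightarrow> ('g list \<Rightarrow>\<^sub>0 'k) set"
where
  "theta G \<sigma> g w =
     (let A = twisted_par_algebra G \<sigma> in
      if \<sigma> g (inv\<^bsub>G\<^esub> g) \<noteq> 0
      then inverse (\<sigma> (inv\<^bsub>G\<^esub> g) g) \<odot>\<^bsub>A\<^esub>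
             (bracket G \<sigma> g \<otimes>\<^bsub>A\<^esub> w \<otimes>\<^bsub>A\<^esub> bracket G \<sigma> (inv\<^bsub>G\<^esub> g))
      else \<zero>\<^bsub>A\<^esub>)"


section \<open>The spectral partial action\<close>

text \<open>
  Characters are functions on the subset \<open>B\<close> of the algebra; being extensional (\<^const>\<open>undefined\<close>
  off \<open>B\<close>) makes equality of characters equality on \<open>B\<close>, and places them in
  \<^const>\<open>product_topology\<close> indexed by \<open>B\<close>.
\<close>

definition characters :: "('k::field, 'a) module \<Rightarrow> 'a set \<Rightarrow> ('a \<Rightarrow> 'k) set" where
  "characters A B = {f \<in> extensional B.
     f \<one>\<^bsub>A\<^esub> = 1 \<and>
     (\<forall>x\<in>B. \<forall>y\<in>B. f (x \<oplus>\<^bsub>A\<^esub> y) = f x + f y \<and> f (x \<otimes>\<^bsub>A\<^esub> y) = f x * f y) \<and>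
     (\<forall>c. \<forall>x\<in>B. f (c \<odot>\<^bsub>A\<^esub> x) = c * f x)}"

definition B_hat ::
  "('g, 'm) monoid_scheme \<Rightarrow> ('g \<Rightarrow> 'g \<Rightarrow> 'k::field) \<Rightarrow> (('g list \<Rightarrow>\<^sub>0 'k) set \<Rightarrow> 'k) set"
where
  "B_hat G \<sigma> = characters (twisted_par_algebra G \<sigma>) (B_alg G \<sigma>)"

definition B_hat_topology ::
  "('g, 'm) monoid_scheme \<Rightarrow> ('g \<Rightarrow> 'g \<Rightarrow> 'k::field) \<Rightarrow>
   (('g list \<Rightarrow>\<^sub>0 'k) set \<Rightarrow> 'k) topology"
where
  "B_hat_topology G \<sigma> =
     subtopology (product_topology (\<lambda>_. discrete_topology UNIV) (B_alg G \<sigma>)) (B_hat G \<sigma>)"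

definition hat_dom ::
  "('g, 'm) monoid_scheme \<Rightarrow> ('g \<Rightarrow> 'g \<Rightarrow> 'k::field) \<Rightarrow> 'g \<Rightarrow>
   (('g list \<Rightarrow>\<^sub>0 'k) set \<Rightarrow> 'k) set"
where
  "hat_dom G \<sigma> g = {f \<in> B_hat G \<sigma>. f (idem G \<sigma> g) = 1}"

definition hat_theta ::
  "('g, 'm) monoid_scheme \<Rightarrow> ('g \<Rightarrow> 'g \<Rightarrow> 'k::field) \<Rightarrow> 'g \<Rightarrow>
   (('g list \<Rightarrow>\<^sub>0 'k) set \<Rightarrow> 'k) \<Rightarrow> (('g list \<Rightarrow>\<^sub>0 'k) set \<Rightarrow> 'k)"
where
  "hat_theta G \<sigma> g f =
     (\<lambda>w\<in>B_alg G \<sigma>.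
        f (theta G \<sigma> (inv\<^bsub>G\<^esub> g) (idem G \<sigma> g \<otimes>\<^bsub>twisted_par_algebra G \<sigma>\<^esub> w)))"

text \<open>
  For a partial action with domains \<open>D (inv g)\<close> and maps \<open>\<phi> g : D (inv g) \<rightarrow> D g\<close>.
\<close>

definition topologically_free ::
  "('g, 'm) monoid_scheme \<Rightarrow> 'x topology \<Rightarrow> ('g \<Rightarrow> 'x set) \<Rightarrow> ('g \<Rightarrow> 'x \<Rightarrow> 'x) \<Rightarrow> bool"
where
  "topologically_free G X D \<phi> \<longleftrightarrow>
     (\<forall>g\<in>carrier G. g \<noteq> \<one>\<^bsub>G\<^esub> \<longrightarrow> X interior_of {x \<in> D (inv\<^bsub>G\<^esub> g). \<phi> g x = x} = {})"

end

theory Submission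
  imports Defs
begin

text \<open>
  The relations give \<open>[g] e\<^sub>h = e\<^sub>g\<^sub>h [g]\<close> and \<open>[g][h] = \<sigma>(g,h) e\<^sub>g [gh]\<close>, so \<open>B\<close> is
  commutative and the algebra is the sum of the subspaces \<open>B [g]\<close>.  Multiply a non-zero element of
  the ideal by some \<open>[h\<^sup>-\<^sup>1]\<close> to bring it to the form \<open>x = c + \<Sum> b\<^sub>g [g]\<close>, summed over \<open>g \<noteq> 1\<close>,
  with \<open>0 \<noteq> c \<in> B\<close>.  If a character \<open>f\<close> of \<open>B\<close> is not fixed by \<open>g\<close>, there is \<open>q \<in> B\<close> with
  \<open>f(q) \<noteq> 0\<close> and \<open>q [g] q = 0\<close>.  Characters separate the points of \<open>B\<close> and
  \<open>{f. f(c) \<noteq> 0}\<close> is open, so topological freeness provides, one \<open>g\<close> at a time, such factors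
  \<open>q\<close> whose product \<open>p\<close> satisfies \<open>c p \<noteq> 0\<close>.  Then \<open>p x p = c p\<^sup>2\<close> is a non-zero element of
  \<open>B\<close>.
\<close>

section \<open>Subalgebras and characters\<close>

context unital_algebra
begin

lemma smult_zero_left: "x \<in> carrier A \<Longrightarrow> 0 \<odot> x = \<zero>"
  using smult_l_distr[of x 0 0] smult_closed[of x 0] add.l_cancel_one' by auto

lemma smult_zero_right: "c \<odot> \<zero> = \<zero>"
  using smult_assoc[of \<zero> c 0] smult_zero_left[of \<zero>] by simp

lemma smult_minus_one: "x \<in> carrier A \<Longrightarrow> (- 1) \<odot> x = \<ominus> x"
  using smult_l_distr[of x "- 1" 1]
  by (intro minus_equality[symmetric]) (auto simp: smult_closed smult_one smult_zero_left)

lemma smult_eq_zeroD: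
  assumes "c \<odot> x = \<zero>" "c \<noteq> 0" "x \<in> carrier A"
  shows "x = \<zero>"
proof -
  have "x = inverse c \<odot> (c \<odot> x)"
    using assms(2,3) by (simp add: smult_assoc[symmetric] smult_one)
  then show ?thesis
    using assms by (simp add: smult_zero_right)
qed

text \<open>Subtraction gives \<open>(c - d) \<odot> x = \<zero>\<close> with \<open>c - d\<close>
  invertible. This is how products are shown to vanish later: a vector with two different
  eigenvalues is zero.\<close>

lemma smult_eq_smultD:
  assumes "c \<odot> x = d \<odot> x" "c \<noteq> d" "x \<in> carrier A"
  shows "x = \<zero>"
proof -
  have "(c - d) \<odot> x = c \<odot> x \<oplus> (- 1) \<odot> (d \<odot> x)"
    using smult_l_distr[of x c "- d"] smult_assoc[of x "- 1" d] assms(3) by simp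
  also have "\<dots> = \<zero>"
    using assms by (simp add: smult_minus_one smult_closed r_neg)
  finally show ?thesis
    using assms smult_eq_zeroD[of "c - d" x] by simp
qed

text \<open>Negatives need no separate check, being multiples by the scalar -1.\<close>

lemma unital_subalgebraI:
  assumes "H \<subseteq> carrier A" "\<one> \<in> H"
    and "\<And>c x. x \<in> H \<Longrightarrow> c \<odot> x \<in> H"
    and "\<And>x y. \<lbrakk>x \<in> H; y \<in> H\<rbrakk> \<Longrightarrow> x \<otimes> y \<in> H"
    and "\<And>x y. \<lbrakk>x \<in> H; y \<in> H\<rbrakk> \<Longrightarrow> x \<oplus> y \<in> H"
  shows "unital_subalgebra H A"
  unfolding unital_subalgebra_def
proof (intro conjI subringI)
  show "\<ominus> h \<in> H" if "h \<in> H" for h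
    using assms(1) assms(3)[OF that, of "- 1"] smult_minus_one[of h] that by auto
qed (use assms in auto)

lemma unital_subalgebra_carrier: "unital_subalgebra (carrier A) A"
  by (rule unital_subalgebraI) (auto simp: smult_closed)

section \<open>Generated subalgebras and their characters\<close>

context
  fixes S :: "'a set"
  assumes S: "S \<subseteq> carrier A"
begin

lemma generated_subalgebra_is_subalgebra: "unital_subalgebra (generated_subalgebra A S) A"
proof -
  have "subring (\<Inter>{B. unital_subalgebra B A \<and> S \<subseteq> B}) A"
    by (rule subring_Inter) (use S unital_subalgebra_carrier in \<open>auto simp: unital_subalgebra_def\<close>)
  then show ?thesis
    by (auto simp: generated_subalgebra_def unital_subalgebra_def)
qed

lemma generated_subalgebra_subset: "generated_subalgebra A S \<subseteq> carrier A"
  using S unital_subalgebra_carrier by (auto simp: generated_subalgebra_def)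

lemma generated_subalgebra_incl: "x \<in> S \<Longrightarrow> x \<in> generated_subalgebra A S"
  by (auto simp: generated_subalgebra_def)

lemma generated_subalgebra_closed:
  shows "\<one> \<in> generated_subalgebra A S"
    and "x \<in> generated_subalgebra A S \<Longrightarrow> c \<odot> x \<in> generated_subalgebra A S"
    and "\<lbrakk>x \<in> generated_subalgebra A S; y \<in> generated_subalgebra A S\<rbrakk>
      \<Longrightarrow> x \<oplus> y \<in> generated_subalgebra A S"
    and "\<lbrakk>x \<in> generated_subalgebra A S; y \<in> generated_subalgebra A S\<rbrakk>
      \<Longrightarrow> x \<otimes> y \<in> generated_subalgebra A S"
    and "x \<in> generated_subalgebra A S \<Longrightarrow> \<ominus> x \<in> generated_subalgebra A S"
    and "\<zero> \<in> generated_subalgebra A S"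
  using generated_subalgebra_is_subalgebra
  by (auto simp: unital_subalgebra_def subringE)

text \<open>The elements of the generated subalgebra with property \<open>P\<close> form a
  subalgebra containing \<open>S\<close>, and the generated one is the smallest such.\<close>

lemma generated_subalgebra_induct [consumes 1, case_names incl one smult add mult]:
  assumes "x \<in> generated_subalgebra A S"
    and "\<And>x. x \<in> S \<Longrightarrow> P x"
    and "P \<one>"
    and "\<And>c x. \<lbrakk>x \<in> generated_subalgebra A S; P x\<rbrakk> \<Longrightarrow> P (c \<odot> x)"
    and "\<And>x y. \<lbrakk>x \<in> generated_subalgebra A S; y \<in> generated_subalgebra A S; P x; P y\<rbrakk>
      \<Longrightarrow> P (x \<oplus> y)"
    and "\<And>x y. \<lbrakk>x \<in> generated_subalgebra A S; y \<in> generated_subalgebra A S; P x; P y\<rbrakk>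
      \<Longrightarrow> P (x \<otimes> y)"
  shows "P x"
proof -
  let ?H = "{x \<in> generated_subalgebra A S. P x}"
  have "unital_subalgebra ?H A"
    by (rule unital_subalgebraI)
      (use assms generated_subalgebra_subset generated_subalgebra_closed in auto)
  moreover have "S \<subseteq> ?H"
    using assms(2) generated_subalgebra_incl by auto
  ultimately have "generated_subalgebra A S \<subseteq> ?H"
    by (auto simp: generated_subalgebra_def)
  then show ?thesis using assms(1) by auto
qed

lemma generated_subalgebra_commute:
  assumes x: "x \<in> generated_subalgebra A S" and z: "z \<in> carrier A"
    and zS: "\<And>s. s \<in> S \<Longrightarrow> z \<otimes> s = s \<otimes> z"
  shows "z \<otimes> x = x \<otimes> z"
  using x
proof (induct rule: generated_subalgebra_induct)
  case (mult x y)
  then have [simp]: "x \<in> carrier A" "y \<in> carrier A"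
    using generated_subalgebra_subset by auto
  have "z \<otimes> (x \<otimes> y) = x \<otimes> z \<otimes> y"
    using mult z by (simp add: m_assoc[symmetric])
  then show ?case
    using mult z by (simp add: m_assoc)
next
  case (smult c x)
  then show ?case
    using z generated_subalgebra_subset by (auto simp: smult_mult_left smult_mult_right)
next
  case (add x y)
  then show ?case
    using z generated_subalgebra_subset by (auto simp: l_distr r_distr subset_iff)
qed (use z zS in auto)

text \<open>Two centralizer arguments: first each generator commutes with \<open>x\<close>, then
  \<open>x\<close>, commuting with all generators, commutes with \<open>y\<close>.\<close>

lemma generated_subalgebra_commutative:
  assumes "\<And>s t. \<lbrakk>s \<in> S; t \<in> S\<rbrakk> \<Longrightarrow> s \<otimes> t = t \<otimes> s"
    and x: "x \<in> generated_subalgebra A S" and y: "y \<in> generated_subalgebra A S"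
  shows "x \<otimes> y = y \<otimes> x"
proof -
  have "x \<otimes> s = s \<otimes> x" if "s \<in> S" for s
    using generated_subalgebra_commute[OF x, of s] assms(1)[OF that] that S by auto
  then show ?thesis
    using generated_subalgebra_commute[OF y, of x] x generated_subalgebra_subset by auto
qed

lemma character_eqs:
  assumes "f \<in> characters A (generated_subalgebra A S)"
  shows "f \<one> = 1"
    and "\<lbrakk>x \<in> generated_subalgebra A S; y \<in> generated_subalgebra A S\<rbrakk> \<Longrightarrow> f (x \<oplus> y) = f x + f y"
    and "\<lbrakk>x \<in> generated_subalgebra A S; y \<in> generated_subalgebra A S\<rbrakk> \<Longrightarrow> f (x \<otimes> y) = f x * f y"
    and "x \<in> generated_subalgebra A S \<Longrightarrow> f (c \<odot> x) = c * f x"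
    and "f \<zero> = 0"
    and "x \<in> generated_subalgebra A S \<Longrightarrow> f (\<ominus> x) = - f x"
proof -
  show 1: "f (c \<odot> x) = c * f x" if "x \<in> generated_subalgebra A S" for c x
    using assms that by (auto simp: characters_def)
  show "f (\<ominus> x) = - f x" if "x \<in> generated_subalgebra A S"
    using 1[OF that, of "- 1"] that generated_subalgebra_subset by (auto simp: smult_minus_one)
  show "f \<zero> = 0"
    using 1[of \<zero> 0] generated_subalgebra_closed(6) by (simp add: smult_zero_right)
qed (use assms in \<open>auto simp: characters_def\<close>)

section \<open>Characters of an algebra generated by commuting idempotents\<close>

context
  assumes idempotents: "\<And>s. s \<in> S \<Longrightarrow> s \<otimes> s = s"
    and commuting: "\<And>s t. \<lbrakk>s \<in> S; t \<in> S\<rbrakk> \<Longrightarrow> s \<otimes> t = t \<otimes> s"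
begin

text \<open>With the subalgebra viewed as an algebra in its own right, the laws hold with membership
  in it as the only side condition; the rewrites keep the operations written as those of
  \<open>A\<close>.\<close>

interpretation generated: unital_algebra "A\<lparr>carrier := generated_subalgebra A S\<rparr>"
  rewrites "carrier (A\<lparr>carrier := generated_subalgebra A S\<rparr>) = generated_subalgebra A S"
    and "mult (A\<lparr>carrier := generated_subalgebra A S\<rparr>) = mult A"
    and "add (A\<lparr>carrier := generated_subalgebra A S\<rparr>) = add A"
    and "one (A\<lparr>carrier := generated_subalgebra A S\<rparr>) = one A"
    and "zero (A\<lparr>carrier := generated_subalgebra A S\<rparr>) = zero A"
    and "smult (A\<lparr>carrier := generated_subalgebra A S\<rparr>) = smult A"
proof -
  have "subring (generated_subalgebra A S) A"
    using generated_subalgebra_is_subalgebra by (simp add: unital_subalgebra_def)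
  from subring_is_ring[OF this]
  have "ring (A\<lparr>carrier := generated_subalgebra A S\<rparr>)" .
  then show "unital_algebra (A\<lparr>carrier := generated_subalgebra A S\<rparr>)"
    unfolding unital_algebra_def unital_algebra_axioms_def
    using generated_subalgebra_subset generated_subalgebra_closed
    by (auto simp: smult_l_distr smult_r_distr smult_assoc smult_one
        smult_mult_left smult_mult_right subset_iff)
qed auto

lemma generated_mult_commute:
  assumes "x \<in> generated_subalgebra A S" "y \<in> generated_subalgebra A S"
  shows "x \<otimes> y = y \<otimes> x"
  using generated_subalgebra_commutative[OF commuting] assms by blast

lemmas generated_smult_simps = generated.smult_closed generated.smult_l_distr generated.smult_r_distr
  generated.smult_assoc generated.smult_mult_left generated.smult_mult_right
  generated.smult_one generated.smult_zero_left

text \<open>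
  On the commuting idempotents the eigenvalues are \<open>0\<close> and \<open>1\<close>, with eigenvectors \<open>1 - s\<close>
  and \<open>s\<close>; eigenvectors multiply.
\<close>

lemma eigenvector_exists:
  assumes T: "T \<subseteq> generated_subalgebra A S" "\<one> \<in> T"
      "\<And>p q. \<lbrakk>p \<in> T; q \<in> T\<rbrakk> \<Longrightarrow> p \<otimes> q \<in> T"
    and ST: "\<And>s. s \<in> S \<Longrightarrow> s \<in> T \<or> \<one> \<ominus> s \<in> T"
    and w: "w \<in> generated_subalgebra A S"
  shows "\<exists>p\<in>T. \<exists>c. p \<otimes> w = c \<odot> p"
proof -
  have combine: "\<exists>p\<in>T. \<exists>c d. p \<otimes> x = c \<odot> p \<and> p \<otimes> y = d \<odot> p"
    if xy: "x \<in> generated_subalgebra A S" "y \<in> generated_subalgebra A S"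
      and "\<exists>p\<in>T. \<exists>c. p \<otimes> x = c \<odot> p" "\<exists>p\<in>T. \<exists>c. p \<otimes> y = c \<odot> p" for x y
  proof -
    obtain p c q d where p: "p \<in> T" "p \<otimes> x = c \<odot> p" and q: "q \<in> T" "q \<otimes> y = d \<odot> q"
      using \<open>\<exists>p\<in>T. \<exists>c. p \<otimes> x = c \<odot> p\<close> \<open>\<exists>p\<in>T. \<exists>c. p \<otimes> y = c \<odot> p\<close> by metis
    have pq: "p \<in> generated_subalgebra A S" "q \<in> generated_subalgebra A S"
      using p q T by auto
    have "p \<otimes> q \<otimes> x = q \<otimes> (p \<otimes> x)"
      using pq xy by (simp add: generated_mult_commute[of p q] generated.m_assoc)
    also have "\<dots> = c \<odot> (p \<otimes> q)"
      using pq p by (simp add: generated_smult_simps generated_mult_commute[of q p])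
    finally have 1: "p \<otimes> q \<otimes> x = c \<odot> (p \<otimes> q)" .
    have "p \<otimes> q \<otimes> y = d \<odot> (p \<otimes> q)"
      using pq xy q by (simp add: generated_smult_simps generated.m_assoc)
    with 1 show ?thesis using T(3)[OF p(1) q(1)] by blast
  qed
  show ?thesis
    using w
  proof (induct rule: generated_subalgebra_induct)
    case (incl s)
    then have s: "s \<in> carrier A" using S by auto
    from ST[OF incl] show ?case
    proof
      assume "s \<in> T"
      then show ?thesis using idempotents[OF incl] s by (metis smult_one)
    next
      assume "\<one> \<ominus> s \<in> T"
      moreover have "(\<one> \<ominus> s) \<otimes> s = 0 \<odot> (\<one> \<ominus> s)"
        using s idempotents[OF incl] by (simp add: smult_zero_left a_minus_def l_distr l_minus r_neg)
      ultimately show ?thesis by blast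
    qed
  next
    case one
    then show ?case using T(2) by (metis one_closed r_one smult_one)
  next
    case (smult c x)
    then obtain p d where "p \<in> T" "p \<otimes> x = d \<odot> p" by blast
    then have "p \<otimes> (c \<odot> x) = (c * d) \<odot> p"
      using smult T(1) by (auto simp: generated_smult_simps)
    with \<open>p \<in> T\<close> show ?case by blast
  next
    case (add x y)
    then obtain p c d where p: "p \<in> T" "p \<otimes> x = c \<odot> p" "p \<otimes> y = d \<odot> p"
      using combine by metis
    then have "p \<otimes> (x \<oplus> y) = (c + d) \<odot> p"
      using add T(1) by (auto simp: generated_smult_simps generated.r_distr)
    with p show ?case by blast
  next
    case (mult x y)
    then obtain p c d where p: "p \<in> T" "p \<otimes> x = c \<odot> p" "p \<otimes> y = d \<odot> p"
      using combine by metis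
    then have "p \<otimes> (x \<otimes> y) = (c * d) \<odot> p"
      using mult T(1) by (auto simp: generated_smult_simps generated.m_assoc[symmetric])
    with p show ?case by blast
  qed
qed

text \<open>A character takes only the values 0 and 1 on idempotents, so the multiplicative set
  \<open>{f = 1}\<close> contains \<open>s\<close> or \<open>\<one> \<ominus> s\<close> for every
  generator, and \<open>eigenvector_exists\<close> applies to it. Evaluating \<open>f\<close> on the
  eigenvalue equation identifies the eigenvalue as \<open>f w\<close>.\<close>

lemma character_eigenvector:
  assumes f: "f \<in> characters A (generated_subalgebra A S)" and w: "w \<in> generated_subalgebra A S"
  obtains p where "p \<in> generated_subalgebra A S" "f p = 1" "p \<otimes> w = f w \<odot> p"
proof -
  let ?T = "{p \<in> generated_subalgebra A S. f p = 1}"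
  have "f s = 0 \<or> f s = 1" if "s \<in> S" for s
    using character_eqs(3)[OF f, of s s] idempotents[OF that] generated_subalgebra_incl[OF that]
    by auto
  then have "s \<in> ?T \<or> \<one> \<ominus> s \<in> ?T" if "s \<in> S" for s
    using that generated_subalgebra_incl[OF that]
    by (auto simp: a_minus_def generated_subalgebra_closed character_eqs[OF f])
  then have "\<exists>p\<in>?T. \<exists>c. p \<otimes> w = c \<odot> p"
    by (intro eigenvector_exists w)
      (auto simp: generated_subalgebra_closed character_eqs[OF f])
  then obtain p c where p: "p \<in> generated_subalgebra A S" "f p = 1" "p \<otimes> w = c \<odot> p"
    by blast
  then have "f w = c"
    using character_eqs(3)[OF f p(1) w] character_eqs(4)[OF f p(1)] by simp
  with p that show ?thesis by blast
qed

text \<open>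
  The character sends \<open>w\<close> to its eigenvalue on a multiplicative set \<open>T\<close> that is maximal
  among those with \<open>0 \<notin> b T\<close>.
\<close>

lemma characters_separate:
  assumes b: "b \<in> generated_subalgebra A S" "b \<noteq> \<zero>"
  obtains f where "f \<in> characters A (generated_subalgebra A S)" "f b \<noteq> 0"
proof -
  let ?B = "generated_subalgebra A S"
  define M where "M = {T. T \<subseteq> ?B \<and> \<one> \<in> T \<and> (\<forall>p\<in>T. \<forall>q\<in>T. p \<otimes> q \<in> T) \<and> (\<forall>p\<in>T. b \<otimes> p \<noteq> \<zero>)}"
  have "\<exists>T\<in>M. \<forall>X\<in>M. T \<subseteq> X \<longrightarrow> X = T"
  proof (rule subset_Zorn_nonempty)
    have "{\<one>} \<in> M"
      using b generated_subalgebra_closed generated_subalgebra_subset by (auto simp: M_def)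
    then show "M \<noteq> {}" by blast
  next
    fix C assume C: "C \<noteq> {}" "subset.chain M C"
    then have CM: "C \<subseteq> M" and lin: "\<And>X Y. \<lbrakk>X \<in> C; Y \<in> C\<rbrakk> \<Longrightarrow> X \<subseteq> Y \<or> Y \<subseteq> X"
      by (auto simp: subset_chain_def)
    have "p \<otimes> q \<in> \<Union>C" if pq: "p \<in> X" "X \<in> C" "q \<in> Y" "Y \<in> C" for p q X Y
    proof -
      from lin[OF pq(2,4)] obtain Z where "Z \<in> C" "p \<in> Z" "q \<in> Z" using pq by blast
      then show ?thesis using CM by (auto simp: M_def)
    qed
    then show "\<Union>C \<in> M"
      using C(1) CM by (auto simp: M_def)
  qed
  then obtain T where T: "T \<in> M" and max: "\<And>X. \<lbrakk>X \<in> M; T \<subseteq> X\<rbrakk> \<Longrightarrow> X = T" by blast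
  have TB: "T \<subseteq> ?B" and T1: "\<one> \<in> T" and Tm: "\<And>p q. \<lbrakk>p \<in> T; q \<in> T\<rbrakk> \<Longrightarrow> p \<otimes> q \<in> T"
    and Tb: "\<And>p. p \<in> T \<Longrightarrow> b \<otimes> p \<noteq> \<zero>"
    using T by (auto simp: M_def)
  have T0: "p \<noteq> \<zero>" if "p \<in> T" for p
    using Tb[OF that] b(1) generated_subalgebra_subset by auto
  \<comment> \<open>For an idempotent \<open>e\<close> the union of \<open>T\<close> and
    \<open>T e\<close> is closed under products. If \<open>b\<close> annihilated no element of it,
    maximality would put \<open>e\<close> into \<open>T\<close>.\<close>
  have extend: "\<exists>p\<in>T. b \<otimes> (p \<otimes> e) = \<zero>" if e: "e \<in> ?B" "e \<otimes> e = e" "e \<notin> T" for e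
  proof (rule ccontr)
    assume contra: "\<not> ?thesis"
    let ?X = "T \<union> (\<lambda>p. p \<otimes> e) ` T"
    have 1: "p \<otimes> (q \<otimes> e) = (p \<otimes> q) \<otimes> e" "(p \<otimes> e) \<otimes> q = (p \<otimes> q) \<otimes> e"
      "(p \<otimes> e) \<otimes> (q \<otimes> e) = (p \<otimes> q) \<otimes> e" if "p \<in> T" "q \<in> T" for p q
    proof -
      have pq: "p \<in> ?B" "q \<in> ?B" using that TB by auto
      show "p \<otimes> (q \<otimes> e) = (p \<otimes> q) \<otimes> e" using pq e by (simp add: generated.m_assoc)
      show "(p \<otimes> e) \<otimes> q = (p \<otimes> q) \<otimes> e"
        using pq e by (simp add: generated.m_assoc generated_mult_commute[of e q])
      have "(p \<otimes> e) \<otimes> (q \<otimes> e) = p \<otimes> (e \<otimes> q) \<otimes> e"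
        using pq e(1) by (simp add: generated.m_assoc)
      also have "\<dots> = p \<otimes> (q \<otimes> (e \<otimes> e))"
        unfolding generated_mult_commute[OF e(1) pq(2)] using pq e(1) by (simp add: generated.m_assoc)
      finally show "(p \<otimes> e) \<otimes> (q \<otimes> e) = (p \<otimes> q) \<otimes> e"
        using pq e by (simp add: generated.m_assoc)
    qed
    have "?X \<in> M"
      using contra TB T1 Tm Tb e(1) generated_subalgebra_closed(4)
      by (auto simp: M_def 1 intro!: imageI)
    with max[of ?X] have "?X = T" by blast
    moreover have "\<one> \<otimes> e \<in> ?X" using T1 by blast
    ultimately show False using e generated_subalgebra_subset by auto
  qed
  \<comment> \<open>Otherwise some \<open>p\<close> and \<open>q\<close> in \<open>T\<close> satisfy
    b p s = 0 and b q (1 - s) = 0. Splitting 1 = s + (1 - s) then gives b p q = 0, although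
    \<open>p \<otimes> q\<close> lies in \<open>T\<close>.\<close>
  have ST: "s \<in> T \<or> \<one> \<ominus> s \<in> T" if s: "s \<in> S" for s
  proof (rule ccontr)
    have sB: "s \<in> ?B" using s generated_subalgebra_incl by auto
    then have sA: "s \<in> carrier A" using generated_subalgebra_subset by auto
    have sB': "\<one> \<ominus> s \<in> ?B"
      using sB by (simp add: a_minus_def generated_subalgebra_closed)
    have "(\<one> \<ominus> s) \<otimes> (\<one> \<ominus> s) = \<one> \<ominus> s"
      using sA idempotents[OF s] by (simp add: a_minus_def l_distr r_distr l_minus r_minus r_neg)
    moreover assume "\<not> (s \<in> T \<or> \<one> \<ominus> s \<in> T)"
    ultimately obtain p q where p: "p \<in> T" "b \<otimes> (p \<otimes> s) = \<zero>"
      and q: "q \<in> T" "b \<otimes> (q \<otimes> (\<one> \<ominus> s)) = \<zero>"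
      using extend[of s] extend[of "\<one> \<ominus> s"] sB sB' idempotents[OF s] by auto
    have pq: "p \<in> ?B" "q \<in> ?B" using p q TB by auto
    have carr: "p \<in> carrier A" "q \<in> carrier A" "b \<in> carrier A"
      using pq b(1) generated_subalgebra_subset by auto
    have "b \<otimes> (p \<otimes> q) = b \<otimes> (p \<otimes> q) \<otimes> (s \<oplus> (\<one> \<ominus> s))"
      using carr sA by (simp add: a_minus_def a_lcomm[of s] r_neg)
    also have "\<dots> = b \<otimes> (p \<otimes> q) \<otimes> s \<oplus> b \<otimes> (p \<otimes> q) \<otimes> (\<one> \<ominus> s)"
      using carr sA by (simp add: r_distr)
    also have "b \<otimes> (p \<otimes> q) \<otimes> s = b \<otimes> (p \<otimes> s) \<otimes> q"
      using carr sA by (simp add: m_assoc generated_mult_commute[OF pq(2) sB])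
    also have "b \<otimes> (p \<otimes> q) \<otimes> (\<one> \<ominus> s) = b \<otimes> (q \<otimes> (\<one> \<ominus> s)) \<otimes> p"
      using carr sA by (simp add: generated_mult_commute[OF pq] m_assoc generated_mult_commute[OF pq(1) sB'])
    finally have "b \<otimes> (p \<otimes> q) = \<zero>"
      using p q carr by simp
    then show False using Tb Tm p q by blast
  qed
  define f where "f = (\<lambda>w\<in>?B. THE c. \<exists>p\<in>T. p \<otimes> w = c \<odot> p)"
  \<comment> \<open>The eigenvalue does not depend on the eigenvector: if \<open>p\<close> and
    \<open>q\<close> had different eigenvalues, \<open>p \<otimes> q\<close> would have both and
    vanish, but \<open>T\<close> does not contain zero.\<close>
  have f_eq: "f w = c" if w: "w \<in> ?B" and p: "p \<in> T" "p \<otimes> w = c \<odot> p" for w p c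
  proof -
    have "d = c" if q: "q \<in> T" "q \<otimes> w = d \<odot> q" for q d
    proof (rule ccontr)
      assume "d \<noteq> c"
      have pq: "p \<in> ?B" "q \<in> ?B" using p q TB by auto
      have "d \<odot> (p \<otimes> q) = p \<otimes> q \<otimes> w"
        using pq w q by (simp add: generated.m_assoc generated_smult_simps)
      also have "\<dots> = q \<otimes> (p \<otimes> w)"
        using pq w by (simp add: generated_mult_commute[of p q] generated.m_assoc)
      also have "\<dots> = c \<odot> (p \<otimes> q)"
        using pq p by (simp add: generated_smult_simps generated_mult_commute[of q p])
      finally have "p \<otimes> q = \<zero>"
        using \<open>d \<noteq> c\<close> pq by (intro generated.smult_eq_smultD[of d _ c]) auto
      then show False using T0 Tm p q by blast
    qed
    then have "(THE c. \<exists>p\<in>T. p \<otimes> w = c \<odot> p) = c"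
      using p by (intro the_equality) blast+
    then show ?thesis using w by (simp add: f_def)
  qed
  have eigen: "\<exists>p\<in>T. p \<otimes> w = f w \<odot> p" if w: "w \<in> ?B" for w
  proof -
    have "\<exists>p\<in>T. \<exists>c. p \<otimes> w = c \<odot> p"
      by (rule eigenvector_exists) (use TB T1 Tm ST w in auto)
    then show ?thesis using f_eq[OF w] by blast
  qed
  have "f (c \<odot> x) = c * f x" if x: "x \<in> ?B" for c x
  proof -
    obtain p where "p \<in> T" "p \<otimes> x = f x \<odot> p" using eigen[OF x] by blast
    then show ?thesis
      using x TB by (intro f_eq[of _ p]) (auto simp: generated_smult_simps)
  qed
  \<comment> \<open>The product of an eigenvector of \<open>x\<close> and one of \<open>y\<close> is
    an eigenvector of both, on which sum and product have the expected eigenvalues.\<close>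
  moreover have "f (x \<oplus> y) = f x + f y \<and> f (x \<otimes> y) = f x * f y" if xy: "x \<in> ?B" "y \<in> ?B" for x y
  proof -
    obtain p q where p: "p \<in> T" "p \<otimes> x = f x \<odot> p" and q: "q \<in> T" "q \<otimes> y = f y \<odot> q"
      using eigen xy by meson
    have pq: "p \<in> ?B" "q \<in> ?B" using p q TB by auto
    have x: "p \<otimes> q \<otimes> x = f x \<odot> (p \<otimes> q)"
      using pq xy p by (simp add: generated_mult_commute[of p q] generated.m_assoc generated_smult_simps)
    have y: "p \<otimes> q \<otimes> y = f y \<odot> (p \<otimes> q)"
      using pq xy q by (simp add: generated.m_assoc generated_smult_simps)
    have "p \<otimes> q \<otimes> (x \<oplus> y) = (f x + f y) \<odot> (p \<otimes> q)"
      using pq xy x y by (simp add: generated.r_distr generated_smult_simps)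
    moreover have "p \<otimes> q \<otimes> (x \<otimes> y) = p \<otimes> q \<otimes> x \<otimes> y"
      using pq xy by (simp add: generated.m_assoc)
    then have "p \<otimes> q \<otimes> (x \<otimes> y) = (f x * f y) \<odot> (p \<otimes> q)"
      using pq xy y unfolding x by (simp add: generated_smult_simps)
    ultimately show ?thesis
      using f_eq[OF _ Tm[OF p(1) q(1)]] xy generated_subalgebra_closed(3,4)[OF xy] by blast
  qed
  moreover have "f \<one> = 1"
    using T1 generated.smult_one[of \<one>] by (intro f_eq[of _ \<one>]) auto
  ultimately have "f \<in> characters A ?B"
    by (auto simp: characters_def f_def)
  moreover have "f b \<noteq> 0"
  proof
    assume "f b = 0"
    then obtain p where p: "p \<in> T" "p \<otimes> b = 0 \<odot> p" using eigen[OF b(1)] by auto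
    then have "b \<otimes> p = \<zero>"
      using TB b(1) generated_mult_commute[of p b] by (auto simp: generated_smult_simps)
    then show False using Tb p by blast
  qed
  ultimately show ?thesis using that by blast
qed

end

end

end

section \<open>Algebras generated by a twisted partial representation\<close>

text \<open>Keeps of the presentation only that the images of the generators satisfy the relations
  and generate the algebra. Computations with cosets of polynomials are thus confined to one
  interpretation.\<close>

locale twisted_partial_rep = unital_algebra A + G: group G
  for A :: "('k::field, 'a) module" (structure) and G :: "('g, 'm) monoid_scheme" +
  fixes \<sigma> :: "'g \<Rightarrow> 'g \<Rightarrow> 'k" and \<gamma> :: "'g \<Rightarrow> 'a"
  assumes \<gamma>_closed [simp, intro]: "g \<in> carrier G \<Longrightarrow> \<gamma> g \<in> carrier A"
    and \<gamma>_one [simp]: "\<gamma> \<one>\<^bsub>G\<^esub> = \<one>"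
    and rel_zero_left: "\<lbrakk>g \<in> carrier G; h \<in> carrier G; \<sigma> g h = 0\<rbrakk>
      \<Longrightarrow> \<gamma> (inv\<^bsub>G\<^esub> g) \<otimes> \<gamma> (g \<otimes>\<^bsub>G\<^esub> h) = \<zero>"
    and rel_zero_right: "\<lbrakk>g \<in> carrier G; h \<in> carrier G; \<sigma> g h = 0\<rbrakk>
      \<Longrightarrow> \<gamma> (g \<otimes>\<^bsub>G\<^esub> h) \<otimes> \<gamma> (inv\<^bsub>G\<^esub> h) = \<zero>"
    and rel_left: "\<lbrakk>g \<in> carrier G; h \<in> carrier G\<rbrakk>
      \<Longrightarrow> \<gamma> (inv\<^bsub>G\<^esub> g) \<otimes> \<gamma> g \<otimes> \<gamma> h = \<sigma> g h \<odot> (\<gamma> (inv\<^bsub>G\<^esub> g) \<otimes> \<gamma> (g \<otimes>\<^bsub>G\<^esub> h))"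
    and rel_right: "\<lbrakk>g \<in> carrier G; h \<in> carrier G\<rbrakk>
      \<Longrightarrow> \<gamma> g \<otimes> \<gamma> h \<otimes> \<gamma> (inv\<^bsub>G\<^esub> h) = \<sigma> g h \<odot> (\<gamma> (g \<otimes>\<^bsub>G\<^esub> h) \<otimes> \<gamma> (inv\<^bsub>G\<^esub> h))"
    and generated: "generated_subalgebra A (\<gamma> ` carrier G) = carrier A"
begin

text \<open>\<open>e\<close>, \<open>B\<close> and \<open>\<theta>\<close> mirror
  \<open>idem\<close>, \<open>B_alg\<close> and \<open>theta\<close>, with \<open>\<gamma>\<close>
  in place of \<open>bracket\<close>; they are identified in the final proof.\<close>

definition e :: "'g \<Rightarrow> 'a" where
  "e g = (if \<sigma> g (inv\<^bsub>G\<^esub> g) \<noteq> 0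
    then inverse (\<sigma> g (inv\<^bsub>G\<^esub> g)) \<odot> (\<gamma> g \<otimes> \<gamma> (inv\<^bsub>G\<^esub> g)) else \<zero>)"

definition B :: "'a set" where
  "B = generated_subalgebra A (e ` carrier G)"

definition \<theta> :: "'g \<Rightarrow> 'a \<Rightarrow> 'a" where
  "\<theta> g w = (if \<sigma> g (inv\<^bsub>G\<^esub> g) \<noteq> 0
    then inverse (\<sigma> (inv\<^bsub>G\<^esub> g) g) \<odot> (\<gamma> g \<otimes> w \<otimes> \<gamma> (inv\<^bsub>G\<^esub> g)) else \<zero>)"

section \<open>Relations between the generators and the idempotents\<close>

lemmas smult_simps = smult_mult_left smult_mult_right smult_assoc[symmetric]

text \<open>The left relation at (g^-1, g) and the right one at (g, g^-1), where the group product
  is 1. The same element comes out with two scalars, which must agree unless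
  \<open>\<gamma> g\<close> is zero.\<close>

lemma \<gamma>_\<gamma>_inv_\<gamma>:
  assumes "g \<in> carrier G"
  shows "\<gamma> g \<otimes> \<gamma> (inv\<^bsub>G\<^esub> g) \<otimes> \<gamma> g = \<sigma> (inv\<^bsub>G\<^esub> g) g \<odot> \<gamma> g"
    and "\<gamma> g \<otimes> \<gamma> (inv\<^bsub>G\<^esub> g) \<otimes> \<gamma> g = \<sigma> g (inv\<^bsub>G\<^esub> g) \<odot> \<gamma> g"
  using rel_left[of "inv\<^bsub>G\<^esub> g" g] rel_right[of g "inv\<^bsub>G\<^esub> g"] assms by auto

text \<open>At (g, g^-1) the group product is 1, so in each of the two zero relations only one
  generator other than the unit remains.\<close>

lemma \<gamma>_eq_zero:
  assumes "g \<in> carrier G" "\<sigma> g (inv\<^bsub>G\<^esub> g) = 0"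
  shows "\<gamma> g = \<zero>" "\<gamma> (inv\<^bsub>G\<^esub> g) = \<zero>"
  using rel_zero_left[of g "inv\<^bsub>G\<^esub> g"] rel_zero_right[of g "inv\<^bsub>G\<^esub> g"] assms by auto

lemma \<sigma>_inv_commute:
  assumes "g \<in> carrier G" "\<gamma> g \<noteq> \<zero>"
  shows "\<sigma> (inv\<^bsub>G\<^esub> g) g = \<sigma> g (inv\<^bsub>G\<^esub> g)"
  using smult_eq_smultD[of "\<sigma> (inv\<^bsub>G\<^esub> g) g" "\<gamma> g" "\<sigma> g (inv\<^bsub>G\<^esub> g)"] \<gamma>_\<gamma>_inv_\<gamma>[of g] assms by auto

text \<open>The identity \<open>\<gamma>_\<gamma>_inv_\<gamma>\<close> for g^-1 has
  \<open>\<gamma> g\<close> as its middle factor.\<close>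

lemma \<gamma>_inv_eq_zero:
  assumes "g \<in> carrier G" "\<gamma> g = \<zero>"
  shows "\<gamma> (inv\<^bsub>G\<^esub> g) = \<zero>"
proof (cases "\<sigma> g (inv\<^bsub>G\<^esub> g) = 0")
  case False
  have "\<sigma> g (inv\<^bsub>G\<^esub> g) \<odot> \<gamma> (inv\<^bsub>G\<^esub> g) = \<zero>"
    using \<gamma>_\<gamma>_inv_\<gamma>(1)[of "inv\<^bsub>G\<^esub> g"] assms by simp
  then show ?thesis using False assms smult_eq_zeroD by blast
qed (use \<gamma>_eq_zero assms in auto)

lemma e_closed [simp, intro]: "g \<in> carrier G \<Longrightarrow> e g \<in> carrier A"
  by (auto simp: e_def smult_closed)

lemma e_eq_zero: "\<lbrakk>g \<in> carrier G; \<gamma> g = \<zero>\<rbrakk> \<Longrightarrow> e g = \<zero>"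
  by (auto simp: e_def smult_zero_right)

lemma e_eq:
  assumes "g \<in> carrier G" "\<gamma> g \<noteq> \<zero>"
  shows "e g = inverse (\<sigma> g (inv\<^bsub>G\<^esub> g)) \<odot> (\<gamma> g \<otimes> \<gamma> (inv\<^bsub>G\<^esub> g))" "\<sigma> g (inv\<^bsub>G\<^esub> g) \<noteq> 0"
  using assms \<gamma>_eq_zero by (auto simp: e_def)

text \<open>Frees later computations from the case distinction in \<open>e\<close>: if
  \<open>\<gamma> g\<close> is zero, both sides vanish.\<close>

lemma \<gamma>_mult_\<gamma>_inv:
  assumes "g \<in> carrier G"
  shows "\<gamma> g \<otimes> \<gamma> (inv\<^bsub>G\<^esub> g) = \<sigma> g (inv\<^bsub>G\<^esub> g) \<odot> e g"
proof (cases "\<gamma> g = \<zero>")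
  case True
  then show ?thesis using assms by (simp add: e_eq_zero smult_zero_right)
next
  case False
  then show ?thesis using assms e_eq[of g] by (simp add: smult_simps smult_one)
qed

lemma e_mult_\<gamma> [simp]:
  assumes "g \<in> carrier G"
  shows "e g \<otimes> \<gamma> g = \<gamma> g"
proof (cases "\<gamma> g = \<zero>")
  case False
  then show ?thesis
    using assms by (simp add: e_eq \<gamma>_\<gamma>_inv_\<gamma>(2) smult_simps smult_one)
qed (use assms in simp)

text \<open>\<open>e\<close> is normalised by \<sigma>(g^-1, g) at g^-1 and by \<sigma>(g, g^-1) at
  g, so this uses the first form of \<open>\<gamma>_\<gamma>_inv_\<gamma>\<close> where
  \<open>e_mult_\<gamma>\<close> uses the second.\<close>

lemma \<gamma>_mult_e_inv [simp]:
  assumes "g \<in> carrier G"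
  shows "\<gamma> g \<otimes> e (inv\<^bsub>G\<^esub> g) = \<gamma> g"
proof (cases "\<gamma> g = \<zero>")
  case False
  then have "\<gamma> (inv\<^bsub>G\<^esub> g) \<noteq> \<zero>" using \<gamma>_inv_eq_zero[of "inv\<^bsub>G\<^esub> g"] assms by auto
  then show ?thesis
    using assms False e_eq[of "inv\<^bsub>G\<^esub> g"] \<gamma>_\<gamma>_inv_\<gamma>(1)[of g]
    by (simp add: smult_simps smult_one m_assoc[symmetric])
qed (use assms in simp)

lemma e_idem:
  assumes g: "g \<in> carrier G"
  shows "e g \<otimes> e g = e g"
proof (cases "\<gamma> g = \<zero>")
  case False
  have "e g \<otimes> (\<gamma> g \<otimes> \<gamma> (inv\<^bsub>G\<^esub> g)) = \<gamma> g \<otimes> \<gamma> (inv\<^bsub>G\<^esub> g)"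
    using g by (simp flip: m_assoc)
  then have "e g \<otimes> (c \<odot> (\<gamma> g \<otimes> \<gamma> (inv\<^bsub>G\<^esub> g))) = c \<odot> (\<gamma> g \<otimes> \<gamma> (inv\<^bsub>G\<^esub> g))" for c
    using g by (simp add: smult_mult_right)
  then show ?thesis
    using e_eq(1)[OF g False] by metis
qed (use g in \<open>simp add: e_eq_zero\<close>)

text \<open>Inserting \<open>\<gamma> g = e g \<otimes> \<gamma> g\<close> and expanding
  \<open>e g\<close> produces the triple product of the left relation. The result puts every product
  of two generators into B [gh].\<close>

lemma \<gamma>_mult:
  assumes g: "g \<in> carrier G" and h: "h \<in> carrier G"
  shows "\<gamma> g \<otimes> \<gamma> h = \<sigma> g h \<odot> (e g \<otimes> \<gamma> (g \<otimes>\<^bsub>G\<^esub> h))"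
proof (cases "\<gamma> g = \<zero>")
  case True
  then show ?thesis using assms by (simp add: e_eq_zero smult_zero_right)
next
  case False
  have "\<gamma> g \<otimes> \<gamma> h = e g \<otimes> \<gamma> g \<otimes> \<gamma> h" using g by simp
  also have "\<dots> = inverse (\<sigma> g (inv\<^bsub>G\<^esub> g)) \<odot> (\<gamma> g \<otimes> (\<gamma> (inv\<^bsub>G\<^esub> g) \<otimes> \<gamma> g \<otimes> \<gamma> h))"
    using g h False by (simp add: e_eq smult_mult_left m_assoc)
  also have "\<dots> = \<sigma> g h \<odot> (e g \<otimes> \<gamma> (g \<otimes>\<^bsub>G\<^esub> h))"
    unfolding rel_left[OF g h] using g h False
    by (simp add: e_eq smult_simps m_assoc mult.commute)
  finally show ?thesis .
qed

text \<open>
  Both sides are multiples of \<open>[gh][h\<^sup>-\<^sup>1]\<close>, hence fixed by \<open>e\<^sub>g\<^sub>h\<close> on the left and by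
  \<open>e\<^sub>h\<close> on the right; so both equal \<open>e\<^sub>g\<^sub>h [g] e\<^sub>h\<close>.
\<close>

lemma \<gamma>_mult_e:
  assumes g: "g \<in> carrier G" and h: "h \<in> carrier G"
  shows "\<gamma> g \<otimes> e h = e (g \<otimes>\<^bsub>G\<^esub> h) \<otimes> \<gamma> g"
proof -
  let ?k = "g \<otimes>\<^bsub>G\<^esub> h" and ?h = "inv\<^bsub>G\<^esub> h"
  let ?u = "\<gamma> ?k \<otimes> \<gamma> ?h"
  have k: "?k \<in> carrier G" "?h \<in> carrier G" "?k \<otimes>\<^bsub>G\<^esub> ?h = g"
    using g h by (auto simp: G.m_assoc)
  have "\<exists>c. \<gamma> g \<otimes> e h = c \<odot> ?u"
  proof (cases "\<gamma> h = \<zero>")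
    case True
    then have "\<gamma> g \<otimes> e h = 0 \<odot> ?u"
      using g h by (simp add: e_eq_zero smult_zero_left)
    then show ?thesis by blast
  next
    case False
    have "\<gamma> g \<otimes> e h = inverse (\<sigma> h ?h) \<odot> (\<gamma> g \<otimes> \<gamma> h \<otimes> \<gamma> ?h)"
      using g h False by (simp add: e_eq smult_simps m_assoc)
    then have "\<gamma> g \<otimes> e h = (inverse (\<sigma> h ?h) * \<sigma> g h) \<odot> ?u"
      using g h by (simp add: rel_right smult_assoc)
    then show ?thesis by blast
  qed
  then obtain c where c: "\<gamma> g \<otimes> e h = c \<odot> ?u" by blast
  have "\<exists>d. e ?k \<otimes> \<gamma> g = d \<odot> ?u"
  \<comment> \<open>If \<open>\<sigma> ?k ?h\<close> is zero, \<open>\<gamma>_mult\<close> cannot be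
    solved for \<open>e ?k \<otimes> \<gamma> g\<close>. The zero relation at \<open>?k\<close> and
    \<open>?h\<close>, whose product is g, then makes this element vanish.\<close>
  proof (cases "\<gamma> ?k = \<zero> \<or> \<sigma> ?k ?h = 0")
    case True
    have "e ?k \<otimes> \<gamma> g = \<zero>"
    proof (cases "\<gamma> ?k = \<zero>")
      case False
      with True have "\<gamma> (inv\<^bsub>G\<^esub> ?k) \<otimes> \<gamma> g = \<zero>"
        using rel_zero_left[of ?k ?h] k by simp
      then show ?thesis
        using False g k by (simp add: e_eq smult_mult_left m_assoc smult_zero_right)
    qed (use g k in \<open>simp add: e_eq_zero\<close>)
    then show ?thesis
      using g h by (intro exI[of _ 0]) (simp add: smult_zero_left)
  next
    case False
    have "?u = \<sigma> ?k ?h \<odot> (e ?k \<otimes> \<gamma> g)"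
      using \<gamma>_mult[of ?k ?h] k by simp
    then have "e ?k \<otimes> \<gamma> g = inverse (\<sigma> ?k ?h) \<odot> ?u"
      using False g k by (simp add: smult_assoc[symmetric] smult_one)
    then show ?thesis by blast
  qed
  then obtain d where d: "e ?k \<otimes> \<gamma> g = d \<odot> ?u" by blast
  have "e ?k \<otimes> (\<gamma> g \<otimes> e h) = \<gamma> g \<otimes> e h"
    unfolding c using k by (simp add: smult_mult_right m_assoc[symmetric])
  moreover have "(e ?k \<otimes> \<gamma> g) \<otimes> e h = e ?k \<otimes> \<gamma> g"
    unfolding d using k \<gamma>_mult_e_inv[of ?h] h by (simp add: smult_mult_left m_assoc)
  ultimately show ?thesis
    using g h k by (simp add: m_assoc)
qed

text \<open>\<open>e g\<close> is a multiple of
  \<open>\<gamma> g \<otimes> \<gamma> (inv g)\<close>. Moving \<open>e h\<close> leftwards across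
  the two factors turns it first into the idempotent of g^-1 h and then back into
  \<open>e h\<close>.\<close>

lemma e_commute:
  assumes g: "g \<in> carrier G" and h: "h \<in> carrier G"
  shows "e g \<otimes> e h = e h \<otimes> e g"
proof (cases "\<gamma> g = \<zero>")
  case True
  then show ?thesis using assms by (simp add: e_eq_zero)
next
  case False
  let ?g = "inv\<^bsub>G\<^esub> g"
  have eh: "\<gamma> g \<otimes> e (?g \<otimes>\<^bsub>G\<^esub> h) = e h \<otimes> \<gamma> g"
    using \<gamma>_mult_e[of g "?g \<otimes>\<^bsub>G\<^esub> h"] g h by (simp flip: G.m_assoc)
  have "\<gamma> g \<otimes> \<gamma> ?g \<otimes> e h = \<gamma> g \<otimes> e (?g \<otimes>\<^bsub>G\<^esub> h) \<otimes> \<gamma> ?g"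
    using g h by (simp add: m_assoc \<gamma>_mult_e[of ?g h])
  also have "\<dots> = e h \<otimes> (\<gamma> g \<otimes> \<gamma> ?g)"
    unfolding eh using g h by (simp add: m_assoc)
  finally show ?thesis
    using False g h by (simp add: e_eq(1)[of g] smult_simps)
qed

section \<open>The commutative subalgebra B and its characters\<close>

lemma e_image: "e ` carrier G \<subseteq> carrier A"
  by auto

lemma B_subset: "B \<subseteq> carrier A"
  unfolding B_def by (rule generated_subalgebra_subset[OF e_image])

lemma B_carrier [simp]: "x \<in> B \<Longrightarrow> x \<in> carrier A"
  using B_subset by auto

lemmas B_closed [simp, intro] = generated_subalgebra_closed[OF e_image, folded B_def]

lemmas B_induct = generated_subalgebra_induct[OF e_image, folded B_def,
    consumes 1, case_names incl one smult add mult]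

lemma e_in_B [simp, intro]: "g \<in> carrier G \<Longrightarrow> e g \<in> B"
  unfolding B_def by (rule generated_subalgebra_incl[OF e_image]) auto

lemma B_commute: "\<lbrakk>x \<in> B; y \<in> B\<rbrakk> \<Longrightarrow> x \<otimes> y = y \<otimes> x"
  unfolding B_def by (rule generated_subalgebra_commutative[OF e_image]) (auto intro: e_commute)

lemmas B_character_eqs = character_eqs[OF e_image, folded B_def]

lemma e_image_idem: "s \<in> e ` carrier G \<Longrightarrow> s \<otimes> s = s"
  by (auto intro: e_idem)

lemma e_image_commute: "\<lbrakk>s \<in> e ` carrier G; t \<in> e ` carrier G\<rbrakk> \<Longrightarrow> s \<otimes> t = t \<otimes> s"
  by (auto intro: e_commute)

lemma B_character_eigenvector:
  assumes "f \<in> characters A B" "w \<in> B"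
  obtains p where "p \<in> B" "f p = 1" "p \<otimes> w = f w \<odot> p"
  by (rule character_eigenvector[OF e_image e_image_idem e_image_commute, folded B_def,
        OF _ _ _ assms that])

lemma B_characters_separate:
  assumes "b \<in> B" "b \<noteq> \<zero>"
  obtains f where "f \<in> characters A B" "f b \<noteq> 0"
  by (rule characters_separate[OF e_image e_image_idem e_image_commute, folded B_def,
        OF _ _ _ assms that])

section \<open>Moving elements of B across generators: the partial action\<close>

lemma \<gamma>_mult_B:
  assumes g: "g \<in> carrier G" and b: "b \<in> B"
  shows "\<exists>b'\<in>B. \<gamma> g \<otimes> b = b' \<otimes> \<gamma> g"
  using b
proof (induct rule: B_induct)
  case (incl x)
  then obtain h where "h \<in> carrier G" "x = e h" by auto
  then show ?case using \<gamma>_mult_e[OF g] g by (intro bexI[of _ "e (g \<otimes>\<^bsub>G\<^esub> h)"]) auto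
next
  case one
  then show ?case using g by (intro bexI[of _ \<one>]) auto
next
  case (smult c x)
  then obtain b where "b \<in> B" "\<gamma> g \<otimes> x = b \<otimes> \<gamma> g" by blast
  then show ?case using smult g by (intro bexI[of _ "c \<odot> b"]) (auto simp: smult_simps)
next
  case (add x y)
  then obtain b d where "b \<in> B" "\<gamma> g \<otimes> x = b \<otimes> \<gamma> g" "d \<in> B" "\<gamma> g \<otimes> y = d \<otimes> \<gamma> g" by blast
  then show ?case using add g by (intro bexI[of _ "b \<oplus> d"]) (auto simp: l_distr r_distr)
next
  case (mult x y)
  then obtain b d where bd: "b \<in> B" "\<gamma> g \<otimes> x = b \<otimes> \<gamma> g" "d \<in> B" "\<gamma> g \<otimes> y = d \<otimes> \<gamma> g" by blast
  have "\<gamma> g \<otimes> (x \<otimes> y) = b \<otimes> \<gamma> g \<otimes> y"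
    using mult g bd by (simp add: m_assoc[symmetric])
  also have "\<dots> = b \<otimes> d \<otimes> \<gamma> g"
    using mult g bd by (simp add: m_assoc)
  finally show ?case using bd by (intro bexI[of _ "b \<otimes> d"]) auto
qed

lemma \<theta>_closed:
  assumes g: "g \<in> carrier G" and w: "w \<in> B"
  shows "\<theta> g w \<in> B"
proof -
  obtain w' where "w' \<in> B" "\<gamma> g \<otimes> w = w' \<otimes> \<gamma> g" using \<gamma>_mult_B[OF g w] by blast
  then have "\<gamma> g \<otimes> w \<otimes> \<gamma> (inv\<^bsub>G\<^esub> g) = w' \<otimes> (\<sigma> g (inv\<^bsub>G\<^esub> g) \<odot> e g)"
    using g by (simp add: m_assoc \<gamma>_mult_\<gamma>_inv)
  then show ?thesis
    using g \<open>w' \<in> B\<close> by (auto simp: \<theta>_def)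
qed

text \<open>The partial action describes what \<open>w\<close> becomes when it moves to the right
  across \<open>\<gamma> g\<close>. Composing a character with this map of \<open>w\<close> is the
  formula of \<open>hat_theta\<close>, whence the link between fixed characters and products with
  \<open>\<gamma> g\<close>.\<close>

lemma B_mult_\<gamma>:
  assumes g: "g \<in> carrier G" and w: "w \<in> B"
  shows "w \<otimes> \<gamma> g = \<gamma> g \<otimes> \<theta> (inv\<^bsub>G\<^esub> g) (e g \<otimes> w)"
proof (cases "\<gamma> g = \<zero>")
  case True
  then show ?thesis using g w by (simp add: \<theta>_closed)
next
  case False
  \<comment> \<open>\<open>\<theta> (inv g)\<close> branches on \<sigma>(g^-1, g) but divides by
    \<sigma>(g, g^-1); the two agree because \<open>\<gamma> g\<close> is non-zero.\<close>
  then have \<sigma>: "\<sigma> (inv\<^bsub>G\<^esub> g) g \<noteq> 0"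
    using \<sigma>_inv_commute e_eq(2) g by simp
  have "\<gamma> g \<otimes> \<theta> (inv\<^bsub>G\<^esub> g) (e g \<otimes> w)
      = inverse (\<sigma> g (inv\<^bsub>G\<^esub> g)) \<odot> (\<gamma> g \<otimes> \<gamma> (inv\<^bsub>G\<^esub> g)) \<otimes> (e g \<otimes> w) \<otimes> \<gamma> g"
    using \<sigma> g w by (simp add: \<theta>_def smult_simps m_assoc)
  also have "\<dots> = e g \<otimes> e g \<otimes> w \<otimes> \<gamma> g"
    unfolding e_eq(1)[OF g False, symmetric] using g w by (simp add: m_assoc)
  also have "\<dots> = w \<otimes> (e g \<otimes> \<gamma> g)"
    using g w by (simp add: e_idem B_commute[of "e g" w] m_assoc del: e_mult_\<gamma>)
  finally show ?thesis using g by simp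
qed

text \<open>The hypothesis \<open>moved\<close> spells out that \<open>f\<close> is not a fixed
  point of g: it lies outside the domain, or its image differs from it at some \<open>w\<close>.
  Outside the domain, 1 - \<open>e (inv g)\<close> serves as \<open>q\<close>, since
  \<open>\<gamma> g\<close> absorbs \<open>e (inv g)\<close>. Otherwise \<open>q\<close> is a
  product of two eigenvectors.\<close>

lemma moved_character_annihilates:
  assumes f: "f \<in> characters A B" and g: "g \<in> carrier G"
    and moved: "f (e (inv\<^bsub>G\<^esub> g)) \<noteq> 1 \<or> (\<exists>w\<in>B. f (\<theta> (inv\<^bsub>G\<^esub> g) (e g \<otimes> w)) \<noteq> f w)"
  obtains q where "q \<in> B" "f q \<noteq> 0" "q \<otimes> \<gamma> g \<otimes> q = \<zero>"
  using moved
proof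
  assume *: "f (e (inv\<^bsub>G\<^esub> g)) \<noteq> 1"
  let ?q = "\<one> \<ominus> e (inv\<^bsub>G\<^esub> g)"
  have q: "?q \<in> B" using g by (simp add: a_minus_def)
  moreover have "f ?q \<noteq> 0"
    using * g by (simp add: a_minus_def B_character_eqs[OF f])
  moreover have "\<gamma> g \<otimes> ?q = \<zero>"
    using g by (simp add: a_minus_def r_distr r_minus r_neg)
  then have "?q \<otimes> \<gamma> g \<otimes> ?q = \<zero>"
    using g q by (simp add: m_assoc del: minus_closed)
  ultimately show thesis using that by blast
next
  assume "\<exists>w\<in>B. f (\<theta> (inv\<^bsub>G\<^esub> g) (e g \<otimes> w)) \<noteq> f w"
  then obtain w where w: "w \<in> B" and "f (\<theta> (inv\<^bsub>G\<^esub> g) (e g \<otimes> w)) \<noteq> f w" by blast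
  moreover define u where "u = \<theta> (inv\<^bsub>G\<^esub> g) (e g \<otimes> w)"
  ultimately have ne: "f u \<noteq> f w" by simp
  have u: "u \<in> B" using w g by (auto simp: u_def intro: \<theta>_closed)
  have wu: "w \<otimes> \<gamma> g = \<gamma> g \<otimes> u" using B_mult_\<gamma>[OF g w] by (simp add: u_def)
  obtain p where p: "p \<in> B" "f p = 1" "p \<otimes> w = f w \<odot> p"
    using B_character_eigenvector[OF f w] .
  obtain q where q: "q \<in> B" "f q = 1" "q \<otimes> u = f u \<odot> q"
    using B_character_eigenvector[OF f u] .
  \<comment> \<open>On the left of \<open>\<gamma> g\<close> the element \<open>w\<close> acts on
    \<open>p\<close> as \<open>f w\<close>; moved across, it becomes \<open>u\<close> and acts on
    \<open>q\<close> as \<open>f u\<close>. As these scalars differ, the sandwich vanishes.\<close>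
  have "f w \<odot> (p \<otimes> \<gamma> g \<otimes> q) = p \<otimes> (w \<otimes> \<gamma> g) \<otimes> q"
    using p q(1) g w by (simp add: smult_simps flip: m_assoc)
  also have "\<dots> = p \<otimes> \<gamma> g \<otimes> (q \<otimes> u)"
    using p(1) q(1) g u by (simp add: wu m_assoc B_commute[of q u])
  also have "\<dots> = f u \<odot> (p \<otimes> \<gamma> g \<otimes> q)"
    using p(1) q g by (simp add: smult_simps)
  finally have 0: "p \<otimes> \<gamma> g \<otimes> q = \<zero>"
    using ne p q g smult_eq_smultD[of "f w" "p \<otimes> \<gamma> g \<otimes> q" "f u"] by auto
  have "(p \<otimes> q) \<otimes> \<gamma> g \<otimes> (p \<otimes> q) = q \<otimes> (p \<otimes> \<gamma> g \<otimes> q) \<otimes> p"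
    using p(1) q(1) g by (simp add: B_commute[of p q] m_assoc)
  then have "(p \<otimes> q) \<otimes> \<gamma> g \<otimes> (p \<otimes> q) = \<zero>"
    using p(1) q(1) by (simp add: 0)
  moreover have "f (p \<otimes> q) \<noteq> 0" using p q by (simp add: B_character_eqs[OF f])
  ultimately show thesis using that[of "p \<otimes> q"] p q by blast
qed

text \<open>The sum of the subspaces B [g]. Coefficients are zero off \<open>F\<close> so that two
  such sums can be added over the union of their index sets.\<close>

definition B_span :: "'a set" where
  "B_span = {x. \<exists>F b. finite F \<and> F \<subseteq> carrier G \<and> (\<forall>g\<in>carrier G. b g \<in> B) \<and>
    (\<forall>g. g \<notin> F \<longrightarrow> b g = \<zero>) \<and> x = (\<Oplus>g\<in>F. b g \<otimes> \<gamma> g)}"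

lemma B_span_single:
  assumes "b \<in> B" "g \<in> carrier G"
  shows "b \<otimes> \<gamma> g \<in> B_span"
  unfolding B_span_def
  using assms by (intro CollectI exI[of _ "{g}"] exI[of _ "\<lambda>h. if h = g then b else \<zero>"]) auto

lemma B_span_carrier: "x \<in> B_span \<Longrightarrow> x \<in> carrier A"
  by (force simp: B_span_def intro!: finsum_closed)

lemma B_span_add:
  assumes "x \<in> B_span" "y \<in> B_span"
  shows "x \<oplus> y \<in> B_span"
proof -
  from assms obtain F b F' b' where
    x: "finite F" "F \<subseteq> carrier G" "\<forall>g\<in>carrier G. b g \<in> B" "\<forall>g. g \<notin> F \<longrightarrow> b g = \<zero>"
      "x = (\<Oplus>g\<in>F. b g \<otimes> \<gamma> g)" and
    y: "finite F'" "F' \<subseteq> carrier G" "\<forall>g\<in>carrier G. b' g \<in> B" "\<forall>g. g \<notin> F' \<longrightarrow> b' g = \<zero>"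
      "y = (\<Oplus>g\<in>F'. b' g \<otimes> \<gamma> g)"
    by (auto simp: B_span_def)
  have "x = (\<Oplus>g\<in>F \<union> F'. b g \<otimes> \<gamma> g)" "y = (\<Oplus>g\<in>F \<union> F'. b' g \<otimes> \<gamma> g)"
    unfolding x(5) y(5) using x(1-4) y(1-4)
    by (auto intro!: add.finprod_mono_neutral_cong_left simp: subset_iff)
  then have "x \<oplus> y = (\<Oplus>g\<in>F \<union> F'. b g \<otimes> \<gamma> g \<oplus> b' g \<otimes> \<gamma> g)"
    using x y by (subst finsum_addf) (auto simp: subset_iff)
  also have "\<dots> = (\<Oplus>g\<in>F \<union> F'. (b g \<oplus> b' g) \<otimes> \<gamma> g)"
    using x y by (intro finsum_cong) (auto simp: l_distr subset_iff simp_implies_def)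
  finally show ?thesis
    unfolding B_span_def using x y
    by (intro CollectI exI[of _ "F \<union> F'"] exI[of _ "\<lambda>g. b g \<oplus> b' g"]) auto
qed

lemma B_span_finsum:
  assumes "finite F" "\<And>i. i \<in> F \<Longrightarrow> t i \<in> B_span"
  shows "(\<Oplus>i\<in>F. t i) \<in> B_span"
  using assms
proof (induct F)
  case empty
  then show ?case
    using B_span_single[of \<zero> "\<one>\<^bsub>G\<^esub>"] by simp
next
  case (insert i F)
  then show ?case by (auto simp: B_span_carrier intro!: B_span_add)
qed

text \<open>\<open>B_span\<close> contains the unit and is stable under left multiplication by each
  generator, by \<open>\<gamma>_mult_B\<close> and \<open>\<gamma>_mult\<close>; the generators
  generate everything.\<close>

lemma B_span_eq_carrier: "B_span = carrier A"
proof
  show "B_span \<subseteq> carrier A" by (auto intro: B_span_carrier)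
  have \<gamma>G: "\<gamma> ` carrier G \<subseteq> carrier A" by auto
  \<comment> \<open>Quantifying over all \<open>y\<close> makes the property pass from two factors
    to their product.\<close>
  have "\<forall>y\<in>B_span. x \<otimes> y \<in> B_span" if x: "x \<in> generated_subalgebra A (\<gamma> ` carrier G)" for x
    using x
  proof (induct rule: generated_subalgebra_induct[OF \<gamma>G, consumes 1,
        case_names incl one smult add mult])
    case (incl x)
    then obtain h where h: "h \<in> carrier G" "x = \<gamma> h" by auto
    show ?case
    proof
      fix y assume "y \<in> B_span"
      then obtain F b where y: "finite F" "F \<subseteq> carrier G" "\<forall>g\<in>carrier G. b g \<in> B"
        "y = (\<Oplus>g\<in>F. b g \<otimes> \<gamma> g)" by (auto simp: B_span_def)
      then have "\<gamma> h \<otimes> y = (\<Oplus>g\<in>F. \<gamma> h \<otimes> (b g \<otimes> \<gamma> g))"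
        using h by (auto simp: subset_iff intro!: finsum_rdistr)
      moreover have "\<gamma> h \<otimes> (b g \<otimes> \<gamma> g) \<in> B_span" if "g \<in> F" for g
      proof -
        have g: "g \<in> carrier G" "b g \<in> B" using that y by auto
        then obtain b' where b': "b' \<in> B" "\<gamma> h \<otimes> b g = b' \<otimes> \<gamma> h" using \<gamma>_mult_B h by blast
        have "\<gamma> h \<otimes> (b g \<otimes> \<gamma> g) = \<gamma> h \<otimes> b g \<otimes> \<gamma> g" using g h by (simp add: m_assoc)
        also have "\<dots> = b' \<otimes> (\<gamma> h \<otimes> \<gamma> g)" using g h b' by (simp add: m_assoc)
        also have "\<dots> = (\<sigma> h g \<odot> (b' \<otimes> e h)) \<otimes> \<gamma> (h \<otimes>\<^bsub>G\<^esub> g)"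
          using g h b'(1) by (simp add: \<gamma>_mult smult_simps m_assoc)
        also have "\<dots> \<in> B_span"
          using g h b'(1) by (intro B_span_single) auto
        finally show ?thesis .
      qed
      ultimately show "x \<otimes> y \<in> B_span" using y(1) h by (auto intro: B_span_finsum)
    qed
  next
    case one
    then show ?case by (simp add: B_span_carrier)
  next
    case (smult c x)
    have "c \<odot> y \<in> B_span" if "y \<in> B_span" for y
    proof -
      from that obtain F b where y: "finite F" "F \<subseteq> carrier G" "\<forall>g\<in>carrier G. b g \<in> B"
        "y = (\<Oplus>g\<in>F. b g \<otimes> \<gamma> g)" by (auto simp: B_span_def)
      have "c \<odot> y = (c \<odot> \<one>) \<otimes> y"
        using that by (simp add: B_span_carrier smult_mult_left)
      also have "\<dots> = (\<Oplus>g\<in>F. (c \<odot> \<one>) \<otimes> (b g \<otimes> \<gamma> g))"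
        unfolding y(4) using y(1-3) by (auto simp: subset_iff smult_closed intro!: finsum_rdistr)
      also have "\<dots> \<in> B_span"
      proof (rule B_span_finsum[OF y(1)])
        fix g assume "g \<in> F"
        then have "g \<in> carrier G" "b g \<in> B" using y by auto
        then have "(c \<odot> \<one>) \<otimes> (b g \<otimes> \<gamma> g) = (c \<odot> b g) \<otimes> \<gamma> g"
          by (simp add: smult_mult_left)
        then show "(c \<odot> \<one>) \<otimes> (b g \<otimes> \<gamma> g) \<in> B_span"
          using \<open>g \<in> carrier G\<close> \<open>b g \<in> B\<close> by (simp only: B_span_single B_closed)
      qed
      finally show ?thesis .
    qed
    then show ?case
      using smult generated_subalgebra_subset[OF \<gamma>G] by (auto simp: smult_mult_left B_span_carrier subset_iff)
  next
    case (add x y)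
    then show ?case
      using generated_subalgebra_subset[OF \<gamma>G]
      by (auto simp: l_distr B_span_carrier B_span_add subset_iff)
  next
    case (mult x y)
    then show ?case
      using generated_subalgebra_subset[OF \<gamma>G] by (auto simp: m_assoc B_span_carrier subset_iff)
  qed
  moreover have "\<one> \<in> B_span"
    using B_span_single[of \<one> "\<one>\<^bsub>G\<^esub>"] by simp
  ultimately have "x \<otimes> \<one> \<in> B_span" if "x \<in> carrier A" for x
    using that generated by blast
  then show "carrier A \<subseteq> B_span" by force
qed

text \<open>Topological freeness in algebraic form: a non-empty set of characters not vanishing at
  \<open>c\<close> is not contained in the fixed points of any g other than 1.\<close>

context
  assumes moved: "\<And>g c. \<lbrakk>g \<in> carrier G; g \<noteq> \<one>\<^bsub>G\<^esub>; c \<in> B; \<exists>f\<in>characters A B. f c \<noteq> 0\<rbrakk>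
    \<Longrightarrow> \<exists>f\<in>characters A B. f c \<noteq> 0 \<and>
      (f (e (inv\<^bsub>G\<^esub> g)) \<noteq> 1 \<or> (\<exists>w\<in>B. f (\<theta> (inv\<^bsub>G\<^esub> g) (e g \<otimes> w)) \<noteq> f w))"
begin

text \<open>Induction on \<open>F\<close>. Given \<open>p\<close> for \<open>F\<close>, some
  character is non-zero at \<open>c \<otimes> p\<close>, so one not fixed by the new g is too and
  supplies \<open>q\<close>. It is also non-zero at c p q, so this product survives; the earlier
  annihilations persist because \<open>p\<close> and \<open>q\<close> commute.\<close>

lemma common_annihilator:
  assumes "finite F" "F \<subseteq> carrier G" "\<one>\<^bsub>G\<^esub> \<notin> F" and c: "c \<in> B" "c \<noteq> \<zero>"
  shows "\<exists>p\<in>B. c \<otimes> p \<noteq> \<zero> \<and> (\<forall>g\<in>F. p \<otimes> \<gamma> g \<otimes> p = \<zero>)"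
  using assms(1-3)
proof (induct F)
  case empty
  then show ?case using c by (intro bexI[of _ \<one>]) auto
next
  case (insert g F)
  then obtain p where p: "p \<in> B" "c \<otimes> p \<noteq> \<zero>" "\<And>h. h \<in> F \<Longrightarrow> p \<otimes> \<gamma> h \<otimes> p = \<zero>"
    by auto
  have "\<exists>f\<in>characters A B. f (c \<otimes> p) \<noteq> 0"
    using B_characters_separate[of "c \<otimes> p"] p c by blast
  then obtain f where f: "f \<in> characters A B" "f (c \<otimes> p) \<noteq> 0"
    "f (e (inv\<^bsub>G\<^esub> g)) \<noteq> 1 \<or> (\<exists>w\<in>B. f (\<theta> (inv\<^bsub>G\<^esub> g) (e g \<otimes> w)) \<noteq> f w)"
    using moved[of g "c \<otimes> p"] insert.prems p c by auto
  have g: "g \<in> carrier G" using insert.prems by simp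
  obtain q where q: "q \<in> B" "f q \<noteq> 0" "q \<otimes> \<gamma> g \<otimes> q = \<zero>"
    using moved_character_annihilates[OF f(1) g f(3)] .
  have "f (c \<otimes> (p \<otimes> q)) \<noteq> 0"
    using f(2) p(1) q(1,2) c(1) by (simp add: B_character_eqs[OF f(1)])
  then have "c \<otimes> (p \<otimes> q) \<noteq> \<zero>" using B_character_eqs(5)[OF f(1)] by auto
  moreover have "(p \<otimes> q) \<otimes> \<gamma> h \<otimes> (p \<otimes> q) = \<zero>" if "h \<in> insert g F" for h
  proof -
    have h: "h \<in> carrier G" using that insert.prems by auto
    have 1: "(p \<otimes> q) \<otimes> \<gamma> h \<otimes> (p \<otimes> q) = q \<otimes> (p \<otimes> \<gamma> h \<otimes> p) \<otimes> q"
      using h p(1) q(1) by (simp add: B_commute[of p q] m_assoc)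
    have 2: "(p \<otimes> q) \<otimes> \<gamma> h \<otimes> (p \<otimes> q) = p \<otimes> (q \<otimes> \<gamma> h \<otimes> q) \<otimes> p"
      using h p(1) q(1) by (simp add: B_commute[of q p] m_assoc)
    show ?thesis using 1 2 that p q by auto
  qed
  ultimately show ?case using p q by (intro bexI[of _ "p \<otimes> q"]) auto
qed

theorem ideal_meets_B:
  assumes I: "ideal I A" and x: "x \<in> I" "x \<noteq> \<zero>"
  shows "\<exists>y\<in>I \<inter> B. y \<noteq> \<zero>"
proof -
  interpret I: ideal I A by fact
  have "x \<in> B_span" using x I.Icarr by (simp add: B_span_eq_carrier)
  then obtain F b where F: "finite F" "F \<subseteq> carrier G" and b: "\<forall>g\<in>carrier G. b g \<in> B"
    and x_eq: "x = (\<Oplus>g\<in>F. b g \<otimes> \<gamma> g)" by (auto simp: B_span_def)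
  obtain h where h: "h \<in> F" "b h \<otimes> \<gamma> h \<noteq> \<zero>"
  proof (cases "\<forall>g\<in>F. b g \<otimes> \<gamma> g = \<zero>")
    case True
    then have "x = (\<Oplus>g\<in>F. \<zero>)" unfolding x_eq by (intro finsum_cong) auto
    then show ?thesis using x by simp
  qed (use that in blast)
  then have hG: "h \<in> carrier G" and bh: "b h \<in> B" using F b by auto
  let ?h = "inv\<^bsub>G\<^esub> h"
  \<comment> \<open>The term of x [h^-1] coming from h, which lies in B because [h][h^-1] is a
    multiple of \<open>e h\<close>. It is non-zero, since multiplying it by
    \<open>\<gamma> h\<close> gives back a non-zero multiple of
    \<open>b h \<otimes> \<gamma> h\<close>.\<close>
  define c where "c = b h \<otimes> \<gamma> h \<otimes> \<gamma> ?h"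
  have c_eq: "c = b h \<otimes> (\<sigma> h ?h \<odot> e h)"
    using hG bh by (simp add: c_def m_assoc \<gamma>_mult_\<gamma>_inv)
  then have cB: "c \<in> B" using hG bh by auto
  have "\<gamma> h \<noteq> \<zero>" using h(2) bh by auto
  have "c \<otimes> \<gamma> h = \<sigma> h ?h \<odot> (b h \<otimes> \<gamma> h)"
    using hG bh by (simp add: c_eq smult_simps m_assoc)
  moreover have "\<dots> \<noteq> \<zero>"
    using smult_eq_zeroD[of "\<sigma> h ?h" "b h \<otimes> \<gamma> h"] h(2) e_eq(2)[OF hG \<open>\<gamma> h \<noteq> \<zero>\<close>] hG bh
    by auto
  ultimately have c0: "c \<noteq> \<zero>" using hG by auto
  \<comment> \<open>The group elements to which the remaining terms of x [h^-1] belong; right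
    translation is injective, so 1 is not among them.\<close>
  let ?F = "(\<lambda>g. g \<otimes>\<^bsub>G\<^esub> ?h) ` (F - {h})"
  have "\<one>\<^bsub>G\<^esub> \<notin> ?F"
    using hG F(2) G.inv_equality[of _ ?h] by (force simp: subset_iff)
  moreover have "?F \<subseteq> carrier G" using F(2) hG by auto
  ultimately obtain p where p: "p \<in> B" "c \<otimes> p \<noteq> \<zero>" "\<And>g. g \<in> ?F \<Longrightarrow> p \<otimes> \<gamma> g \<otimes> p = \<zero>"
    using common_annihilator[of ?F c] F(1) cB c0 by blast
  \<comment> \<open>By \<open>\<gamma>_mult\<close> the two generators merge into a multiple of
    \<open>e g \<otimes> \<gamma> ?k\<close>. The coefficients from B commute with the left
    \<open>p\<close>, which leaves the sandwich that \<open>p\<close> annihilates.\<close>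
  have other: "p \<otimes> (b g \<otimes> \<gamma> g) \<otimes> (\<gamma> ?h \<otimes> p) = \<zero>" if g: "g \<in> F" "g \<noteq> h" for g
  proof -
    let ?k = "g \<otimes>\<^bsub>G\<^esub> ?h"
    have gG: "g \<in> carrier G" "b g \<in> B" using g F b by auto
    have "p \<otimes> (b g \<otimes> \<gamma> g) \<otimes> (\<gamma> ?h \<otimes> p) = p \<otimes> (b g \<otimes> (\<gamma> g \<otimes> \<gamma> ?h)) \<otimes> p"
      using gG hG p(1) by (simp add: m_assoc)
    also have "\<dots> = \<sigma> g ?h \<odot> (p \<otimes> (b g \<otimes> e g) \<otimes> \<gamma> ?k \<otimes> p)"
      using gG hG p(1) by (simp add: \<gamma>_mult smult_simps m_assoc)
    also have "p \<otimes> (b g \<otimes> e g) = (b g \<otimes> e g) \<otimes> p"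
      using gG p(1) by (intro B_commute) auto
    also have "(b g \<otimes> e g) \<otimes> p \<otimes> \<gamma> ?k \<otimes> p = (b g \<otimes> e g) \<otimes> (p \<otimes> \<gamma> ?k \<otimes> p)"
      using gG hG p(1) by (simp add: m_assoc)
    also have "\<dots> = \<zero>" using p(3)[of ?k] g gG by auto
    finally show ?thesis by (simp add: smult_zero_right)
  qed
  have "p \<otimes> x \<otimes> (\<gamma> ?h \<otimes> p) = (\<Oplus>g\<in>F. p \<otimes> (b g \<otimes> \<gamma> g) \<otimes> (\<gamma> ?h \<otimes> p))"
    unfolding x_eq using F b p hG
    by (subst finsum_rdistr finsum_ldistr; auto simp: subset_iff Pi_def)+
  also have "\<dots> = (\<Oplus>g\<in>F. if h = g then p \<otimes> (b g \<otimes> \<gamma> g) \<otimes> (\<gamma> ?h \<otimes> p) else \<zero>)"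
    using F b p(1) hG other by (intro finsum_cong) (auto simp: subset_iff simp_implies_def)
  also have "\<dots> = p \<otimes> (b h \<otimes> \<gamma> h) \<otimes> (\<gamma> ?h \<otimes> p)"
    using F b p(1) hG h(1) by (intro finsum_singleton) (auto simp: subset_iff)
  also have "\<dots> = p \<otimes> c \<otimes> p"
    using p(1) hG bh by (simp add: c_def m_assoc)
  finally have eq: "p \<otimes> x \<otimes> (\<gamma> ?h \<otimes> p) = p \<otimes> c \<otimes> p" .
  have "p \<otimes> c \<otimes> p \<in> I"
    unfolding eq[symmetric] using x(1) p(1) hG by (intro I.I_l_closed I.I_r_closed) auto
  moreover have "p \<otimes> c \<otimes> p \<noteq> \<zero>"
  proof -
    \<comment> \<open>Non-vanishing passes from c p to p c p because a character takes values in a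
      field: it is non-zero at both factors.\<close>
    obtain f where f: "f \<in> characters A B" "f (c \<otimes> p) \<noteq> 0"
      using B_characters_separate[of "c \<otimes> p"] cB p by blast
    then have "f (p \<otimes> c \<otimes> p) \<noteq> 0"
      using cB p(1) by (simp add: B_character_eqs)
    then show ?thesis using B_character_eqs(5)[OF f(1)] by auto
  qed
  moreover have "p \<otimes> c \<otimes> p \<in> B" using cB p(1) by auto
  ultimately show ?thesis by blast
qed

end

end

section \<open>The free algebra and its quotients\<close>

text \<open>Recasts \<open>update_induct\<close> with a sum in place of an update, so that
  distributivity applies in the induction step.\<close>

lemma poly_mapping_induct_add [case_names zero add]:
  fixes p :: "'a \<Rightarrow>\<^sub>0 'b::comm_monoid_add"
  assumes "P 0"
    and "\<And>p a b. \<lbrakk>a \<notin> Poly_Mapping.keys p; b \<noteq> 0; P p\<rbrakk> \<Longrightarrow> P (Poly_Mapping.single a b + p)"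
  shows "P p"
proof (induct p rule: update_induct)
  case (update p a b)
  have "Poly_Mapping.update a b p = Poly_Mapping.single a b + p"
    using update(1)
    by (intro poly_mapping_eqI) (auto simp: lookup_add lookup_update lookup_single when_def in_keys_iff)
  then show ?case using assms(2) update by simp
qed (use assms in simp)

text \<open>The neutral word is the empty one, so these are the constant polynomials; they are
  central although words do not commute.\<close>

lemma single_zero_commute:
  fixes p :: "'a::monoid_add \<Rightarrow>\<^sub>0 'k::comm_semiring_1"
  shows "p * Poly_Mapping.single 0 c = Poly_Mapping.single 0 c * p"
  by (induct p rule: poly_mapping_induct_add)
    (simp_all add: distrib_left distrib_right mult_single mult.commute)

lemma keys_mult_lists:
  assumes "Poly_Mapping.keys p \<subseteq> lists X" "Poly_Mapping.keys q \<subseteq> lists X"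
  shows "Poly_Mapping.keys (p * q) \<subseteq> lists X"
  using keys_mult[of p q] assms by (force simp: plus_list_def)

text \<open>Scaling becomes multiplication by a constant, which reduces the scalar axioms to ring
  laws and centrality of constants.\<close>

lemma free_algebra_smult: "c \<odot>\<^bsub>free_algebra G\<^esub> p = Poly_Mapping.single 0 c * p"
  by (simp add: free_algebra_def mult_map_scale_conv_mult)

lemma free_algebra_sel:
  "carrier (free_algebra G) = {p. Poly_Mapping.keys p \<subseteq> lists (carrier G)}"
  "mult (free_algebra G) = (*)" "one (free_algebra G) = 1"
  "zero (free_algebra G) = 0" "add (free_algebra G) = (+)"
  by (simp_all add: free_algebra_def)

lemma free_algebra_unital_algebra:
  fixes G :: "('g, 'm) monoid_scheme"
  shows "unital_algebra (free_algebra G :: ('k::field, 'g list \<Rightarrow>\<^sub>0 'k) module)"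
proof -
  let ?C = "{p. Poly_Mapping.keys p \<subseteq> lists (carrier G)}"
  have add: "p + q \<in> ?C" if "p \<in> ?C" "q \<in> ?C" for p q :: "'g list \<Rightarrow>\<^sub>0 'k"
    using that keys_add[of p q] by auto
  have mult: "p * q \<in> ?C" if "p \<in> ?C" "q \<in> ?C" for p q :: "'g list \<Rightarrow>\<^sub>0 'k"
    using that keys_mult_lists[of p _ q] by auto
  have minus: "- p \<in> ?C" if "p \<in> ?C" for p :: "'g list \<Rightarrow>\<^sub>0 'k"
  proof -
    have "Poly_Mapping.keys (- p) = Poly_Mapping.keys p" by (auto simp: in_keys_iff)
    then show ?thesis using that by auto
  qed
  have const: "Poly_Mapping.single 0 c \<in> ?C" for c :: 'k
    by (auto simp: zero_list_def)
  have "ring (free_algebra G :: ('k, 'g list \<Rightarrow>\<^sub>0 'k) module)"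
  proof (rule ringI)
    show "abelian_group (free_algebra G :: ('k, 'g list \<Rightarrow>\<^sub>0 'k) module)"
    proof (rule abelian_groupI)
      fix p assume "p \<in> carrier (free_algebra G :: ('k, 'g list \<Rightarrow>\<^sub>0 'k) module)"
      then show "\<exists>q\<in>carrier (free_algebra G). q \<oplus>\<^bsub>free_algebra G\<^esub> p = \<zero>\<^bsub>free_algebra G\<^esub>"
        using minus[of p] by (intro bexI[of _ "- p"]) (auto simp: free_algebra_sel)
    qed (use add in \<open>simp_all add: free_algebra_sel ac_simps\<close>)
    show "Group.monoid (free_algebra G :: ('k, 'g list \<Rightarrow>\<^sub>0 'k) module)"
      by (rule monoidI) (use mult const[of 1] in \<open>simp_all add: free_algebra_sel mult.assoc\<close>)
  qed (simp_all add: free_algebra_sel distrib_left distrib_right)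
  then show ?thesis
    unfolding unital_algebra_def unital_algebra_axioms_def free_algebra_smult
  proof (intro conjI allI impI)
    fix c :: 'k and p q :: "'g list \<Rightarrow>\<^sub>0 'k"
    show "p \<otimes>\<^bsub>free_algebra G\<^esub> (Poly_Mapping.single 0 c * q)
        = Poly_Mapping.single 0 c * (p \<otimes>\<^bsub>free_algebra G\<^esub> q)"
      by (simp add: free_algebra_sel single_zero_commute flip: mult.assoc)
  qed (use mult[OF const] in \<open>simp_all add: free_algebra_sel distrib_left distrib_right
        single_add mult_single flip: mult.assoc\<close>)
qed

lemma letter_closed: "g \<in> carrier G \<Longrightarrow> letter g \<in> carrier (free_algebra G)"
  by (simp add: free_algebra_sel)

lemma free_algebra_generated:
  "generated_subalgebra (free_algebra G) (letter ` carrier G) = carrier (free_algebra G)"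
proof -
  interpret F: unital_algebra "free_algebra G" by (rule free_algebra_unital_algebra)
  have L: "letter ` carrier G \<subseteq> carrier (free_algebra G)" by (auto intro: letter_closed)
  note closed = F.generated_subalgebra_closed[OF L]
  let ?gen = "generated_subalgebra (free_algebra G) (letter ` carrier G)"
  have word: "Poly_Mapping.single w 1 \<in> ?gen" if "w \<in> lists (carrier G)" for w
    using that
  proof induct
    case Nil
    then show ?case using closed(1) by (simp add: free_algebra_sel flip: zero_list_def)
  next
    case (Cons a w)
    have eq: "Poly_Mapping.single (a # w) 1 = letter a * Poly_Mapping.single w 1"
      by (simp add: mult_single plus_list_def)
    have "letter a \<in> ?gen" using Cons by (auto intro!: F.generated_subalgebra_incl[OF L])
    with Cons show ?case
      unfolding eq using closed(4) by (simp only: free_algebra_sel)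
  qed
  have "Poly_Mapping.keys p \<subseteq> lists (carrier G) \<Longrightarrow> p \<in> ?gen" for p
  proof (induct p rule: poly_mapping_induct_add)
    case zero
    then show ?case using closed(6) by (simp add: free_algebra_sel)
  next
    case (add p w c)
    then have "Poly_Mapping.keys (Poly_Mapping.single w c + p) = insert w (Poly_Mapping.keys p)"
      by (auto simp: in_keys_iff lookup_add lookup_single when_def split: if_splits)
    then have w: "w \<in> lists (carrier G)" "Poly_Mapping.keys p \<subseteq> lists (carrier G)"
      using add by auto
    have "Poly_Mapping.single w c = c \<odot>\<^bsub>free_algebra G\<^esub> Poly_Mapping.single w 1"
      by (simp add: free_algebra_smult mult_single)
    then have "Poly_Mapping.single w c \<in> ?gen"
      using closed(2)[OF word[OF w(1)]] by simp
    then show ?case using closed(3)[of _ p] add(3) w(2) by (simp add: free_algebra_sel)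
  qed
  then show ?thesis
    using F.generated_subalgebra_subset[OF L] by (auto simp: free_algebra_sel)
qed

section \<open>Quotients of algebras by two-sided ideals\<close>

lemma quotient_algebra_sel:
  "carrier (quotient_algebra A J) = a_rcosets\<^bsub>A\<^esub> J"
  "mult (quotient_algebra A J) = rcoset_mult A J"
  "one (quotient_algebra A J) = J +>\<^bsub>A\<^esub> \<one>\<^bsub>A\<^esub>"
  "zero (quotient_algebra A J) = J"
  "add (quotient_algebra A J) = set_add A"
  by (simp_all add: quotient_algebra_def FactRing_def)

context unital_algebra
begin

context
  fixes J :: "'a set"
  assumes J: "ideal J A"
begin

interpretation J: ideal J A by (rule J)

lemma quotient_algebra_coset:
  shows "carrier (quotient_algebra A J) = (\<lambda>x. J +> x) ` carrier A"
    and "\<lbrakk>x \<in> carrier A; y \<in> carrier A\<rbrakk>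
      \<Longrightarrow> (J +> x) \<otimes>\<^bsub>quotient_algebra A J\<^esub> (J +> y) = J +> (x \<otimes> y)"
    and "\<lbrakk>x \<in> carrier A; y \<in> carrier A\<rbrakk>
      \<Longrightarrow> (J +> x) \<oplus>\<^bsub>quotient_algebra A J\<^esub> (J +> y) = J +> (x \<oplus> y)"
    and "x \<in> carrier A \<Longrightarrow> c \<odot>\<^bsub>quotient_algebra A J\<^esub> (J +> x) = J +> (c \<odot> x)"
proof -
  show "carrier (quotient_algebra A J) = (\<lambda>x. J +> x) ` carrier A"
    by (auto simp: quotient_algebra_sel A_RCOSETS_def')
  show "(J +> x) \<otimes>\<^bsub>quotient_algebra A J\<^esub> (J +> y) = J +> (x \<otimes> y)"
    if "x \<in> carrier A" "y \<in> carrier A"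
    using that by (simp add: quotient_algebra_sel J.rcoset_mult_add)
  show "(J +> x) \<oplus>\<^bsub>quotient_algebra A J\<^esub> (J +> y) = J +> (x \<oplus> y)"
    if "x \<in> carrier A" "y \<in> carrier A"
    using that by (simp add: quotient_algebra_sel J.a_rcos_sum)
  show "c \<odot>\<^bsub>quotient_algebra A J\<^esub> (J +> x) = J +> (c \<odot> x)" if x: "x \<in> carrier A"
  proof -
    \<comment> \<open>Scaling in the quotient is a union over all representatives, hence
      independence of the choice is required. A ring ideal is closed under scalars because c j = (c
      1) j.\<close>
    have "J +> (c \<odot> y) = J +> (c \<odot> x)" if y: "y \<in> J +> x" for y
    proof -
      obtain j where j: "j \<in> J" "y = j \<oplus> x" using y by (auto simp: a_r_coset_def')
      have "c \<odot> j = (c \<odot> \<one>) \<otimes> j" using j J.Icarr by (simp add: smult_mult_left)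
      then have "c \<odot> j \<in> J" using j by (simp add: J.I_l_closed smult_closed)
      moreover have "c \<odot> y = c \<odot> j \<oplus> c \<odot> x" using j J.Icarr x by (simp add: smult_r_distr)
      ultimately have "c \<odot> y \<in> J +> (c \<odot> x)" by (auto simp: a_r_coset_def')
      then show ?thesis using J.a_repr_independence' x by (simp add: smult_closed)
    qed
    moreover have "x \<in> J +> x" using J.a_rcos_self x by simp
    ultimately have "(\<Union>y\<in>J +> x. J +> (c \<odot> y)) = J +> (c \<odot> x)" by blast
    then show ?thesis by (simp add: quotient_algebra_def)
  qed
qed

lemma quotient_algebra_unital_algebra: "unital_algebra (quotient_algebra A J)"
proof -
  let ?Q = "quotient_algebra A J"
  interpret R: ring "A Quot J" by (rule J.quotient_is_ring)
  \<comment> \<open>The quotient ring carries no scalars and is a different record, so its ring laws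
    are transferred operation by operation.\<close>
  have sel: "carrier ?Q = carrier (A Quot J)" "mult ?Q = mult (A Quot J)"
    "one ?Q = one (A Quot J)" "zero ?Q = zero (A Quot J)" "add ?Q = add (A Quot J)"
    by (simp_all add: quotient_algebra_def)
  have "ring ?Q"
  proof (rule ringI)
    show "abelian_group ?Q"
    proof (rule abelian_groupI)
      show "\<exists>y\<in>carrier ?Q. y \<oplus>\<^bsub>?Q\<^esub> x = \<zero>\<^bsub>?Q\<^esub>" if "x \<in> carrier ?Q" for x
        using that R.l_neg R.a_inv_closed unfolding sel by blast
    qed (simp_all add: sel R.a_ac)
    show "Group.monoid ?Q"
      by (rule monoidI) (simp_all add: sel R.m_assoc)
  qed (simp_all add: sel R.l_distr R.r_distr)
  then show ?thesis
    unfolding unital_algebra_def unital_algebra_axioms_def quotient_algebra_coset(1)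
    by (auto simp: quotient_algebra_coset smult_closed smult_l_distr smult_r_distr
        smult_assoc smult_one smult_mult_left smult_mult_right)
qed

lemma quotient_algebra_generated:
  assumes S: "S \<subseteq> carrier A" and gen: "generated_subalgebra A S = carrier A"
  shows "generated_subalgebra (quotient_algebra A J) ((\<lambda>x. J +> x) ` S)
    = carrier (quotient_algebra A J)"
proof -
  interpret Q: unital_algebra "quotient_algebra A J" by (rule quotient_algebra_unital_algebra)
  have S': "(\<lambda>x. J +> x) ` S \<subseteq> carrier (quotient_algebra A J)"
    using S by (auto simp: quotient_algebra_coset(1))
  note closed = Q.generated_subalgebra_closed[OF S']
  have "J +> x \<in> generated_subalgebra (quotient_algebra A J) ((\<lambda>x. J +> x) ` S)"
    if "x \<in> generated_subalgebra A S" for x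
    using that
  proof (induct rule: generated_subalgebra_induct[OF S, consumes 1, case_names incl one smult add mult])
    case (incl x)
    then show ?case by (intro Q.generated_subalgebra_incl[OF S']) auto
  next
    case one
    then show ?case using closed(1) by (simp add: quotient_algebra_sel)
  next
    case (smult c x)
    then show ?case using closed(2) gen by (simp flip: quotient_algebra_coset(4))
  next
    case (add x y)
    then show ?case using closed(3) gen by (simp flip: quotient_algebra_coset(3))
  next
    case (mult x y)
    then show ?case using closed(4) gen by (simp flip: quotient_algebra_coset(2))
  qed
  then show ?thesis
    using Q.generated_subalgebra_subset[OF S'] gen by (auto simp: quotient_algebra_coset(1))
qed

end

end

section \<open>The twisted partial group algebra\<close>

context
  fixes G :: "('g, 'm) monoid_scheme" and \<sigma> :: "'g \<Rightarrow> 'g \<Rightarrow> 'k::field"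
  assumes G: "group G"
begin

interpretation G: group G by (rule G)
interpretation F: unital_algebra "free_algebra G :: ('k, 'g list \<Rightarrow>\<^sub>0 'k) module"
  by (rule free_algebra_unital_algebra)

lemma twisted_relations_closed: "twisted_relations G \<sigma> \<subseteq> carrier (free_algebra G)"
proof -
  have minus: "p - q \<in> carrier (free_algebra G)"
    if "p \<in> carrier (free_algebra G)" "q \<in> carrier (free_algebra G)" for p q :: "'g list \<Rightarrow>\<^sub>0 'k"
  proof -
    have "Poly_Mapping.keys (p - q) \<subseteq> Poly_Mapping.keys p \<union> Poly_Mapping.keys q"
      by (auto simp: in_keys_iff lookup_minus)
    then show ?thesis using that by (auto simp: free_algebra_sel)
  qed
  have mult: "p * q \<in> carrier (free_algebra G)"
    if "p \<in> carrier (free_algebra G)" "q \<in> carrier (free_algebra G)" for p q :: "'g list \<Rightarrow>\<^sub>0 'k"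
    using F.m_closed[OF that] by (simp add: free_algebra_sel)
  have one: "1 \<in> carrier (free_algebra G :: ('k, 'g list \<Rightarrow>\<^sub>0 'k) module)"
    using F.one_closed by (simp add: free_algebra_sel)
  show ?thesis
    unfolding twisted_relations_def
    by (auto intro!: minus mult letter_closed F.smult_closed one)
qed

lemma twisted_ideal_ideal: "ideal (twisted_ideal G \<sigma>) (free_algebra G)"
  unfolding twisted_ideal_def by (rule F.genideal_ideal[OF twisted_relations_closed])

lemma twisted_coset_zero:
  assumes "p \<in> twisted_relations G \<sigma>"
  shows "twisted_ideal G \<sigma> +>\<^bsub>free_algebra G\<^esub> p = twisted_ideal G \<sigma>"
  using F.a_rcos_zero[OF twisted_ideal_ideal] F.genideal_self[OF twisted_relations_closed] assms
  by (auto simp: twisted_ideal_def)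

lemma twisted_coset_eq:
  assumes "p - q \<in> twisted_relations G \<sigma>" "q \<in> carrier (free_algebra G)"
  shows "twisted_ideal G \<sigma> +>\<^bsub>free_algebra G\<^esub> p = twisted_ideal G \<sigma> +>\<^bsub>free_algebra G\<^esub> q"
proof -
  interpret J: ideal "twisted_ideal G \<sigma>" "free_algebra G" by (rule twisted_ideal_ideal)
  have "p - q \<in> twisted_ideal G \<sigma>"
    using F.genideal_self[OF twisted_relations_closed] assms by (auto simp: twisted_ideal_def)
  moreover have "p = (p - q) \<oplus>\<^bsub>free_algebra G\<^esub> q" by (simp add: free_algebra_sel)
  ultimately have "p \<in> twisted_ideal G \<sigma> +>\<^bsub>free_algebra G\<^esub> q"
    unfolding a_r_coset_def' by blast
  then show ?thesis using J.a_repr_independence' assms(2) by simp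
qed

text \<open>Products of brackets are cosets of products of letters. Each relation lies in the ideal,
  so its monomial has the zero coset or its two sides have equal cosets; generation is inherited
  from the free algebra.\<close>

lemma twisted_par_algebra_twisted_partial_rep:
  "twisted_partial_rep (twisted_par_algebra G \<sigma>) G \<sigma> (bracket G \<sigma>)"
proof -
  let ?A = "twisted_par_algebra G \<sigma>"
  let ?J = "twisted_ideal G \<sigma>"
  note coset = F.quotient_algebra_coset[OF twisted_ideal_ideal, folded twisted_par_algebra_def]
  have L: "letter g \<in> carrier (free_algebra G :: ('k, _) module)" if "g \<in> carrier G" for g
    by (rule letter_closed[OF that])
  have mult: "bracket G \<sigma> g \<otimes>\<^bsub>?A\<^esub> bracket G \<sigma> h = ?J +>\<^bsub>free_algebra G\<^esub> (letter g * letter h)"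
    if "g \<in> carrier G" "h \<in> carrier G" for g h
    using that coset(2)[OF L L] by (simp add: bracket_def free_algebra_sel)
  have LL: "letter g * letter h \<in> carrier (free_algebra G :: ('k, _) module)"
    if "g \<in> carrier G" "h \<in> carrier G" for g h
    using F.m_closed[OF L L] that by (simp add: free_algebra_sel)
  have mult3: "bracket G \<sigma> g \<otimes>\<^bsub>?A\<^esub> bracket G \<sigma> h \<otimes>\<^bsub>?A\<^esub> bracket G \<sigma> k
      = ?J +>\<^bsub>free_algebra G\<^esub> (letter g * letter h * letter k)"
    if "g \<in> carrier G" "h \<in> carrier G" "k \<in> carrier G" for g h k
    using that coset(2)[OF LL L] by (simp add: mult) (simp add: bracket_def free_algebra_sel)
  have zero: "\<zero>\<^bsub>?A\<^esub> = ?J"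
    by (simp add: twisted_par_algebra_def quotient_algebra_sel)
  show ?thesis
  proof (intro twisted_partial_rep.intro twisted_partial_rep_axioms.intro)
    show "unital_algebra ?A"
      unfolding twisted_par_algebra_def
      by (rule F.quotient_algebra_unital_algebra[OF twisted_ideal_ideal])
    show "group G" by (rule G)
    show "bracket G \<sigma> g \<in> carrier ?A" if "g \<in> carrier G" for g
      using L that by (auto simp: coset(1) bracket_def)
    have "letter \<one>\<^bsub>G\<^esub> - 1 \<in> twisted_relations G \<sigma>"
      by (simp add: twisted_relations_def)
    from twisted_coset_eq[OF this] show "bracket G \<sigma> \<one>\<^bsub>G\<^esub> = \<one>\<^bsub>?A\<^esub>"
      using F.one_closed
      by (simp add: bracket_def twisted_par_algebra_def quotient_algebra_sel free_algebra_sel(3))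
    fix g h assume g: "g \<in> carrier G" and h: "h \<in> carrier G"
    note gh = g h G.inv_closed[OF g] G.inv_closed[OF h] G.m_closed[OF g h]
    show "bracket G \<sigma> (inv\<^bsub>G\<^esub> g) \<otimes>\<^bsub>?A\<^esub> bracket G \<sigma> (g \<otimes>\<^bsub>G\<^esub> h) = \<zero>\<^bsub>?A\<^esub>" if "\<sigma> g h = 0"
    proof -
      have "letter (inv\<^bsub>G\<^esub> g) * letter (g \<otimes>\<^bsub>G\<^esub> h) \<in> twisted_relations G \<sigma>"
        unfolding twisted_relations_def using g h that by blast
      then show ?thesis using gh by (simp add: mult zero twisted_coset_zero)
    qed
    show "bracket G \<sigma> (g \<otimes>\<^bsub>G\<^esub> h) \<otimes>\<^bsub>?A\<^esub> bracket G \<sigma> (inv\<^bsub>G\<^esub> h) = \<zero>\<^bsub>?A\<^esub>" if "\<sigma> g h = 0"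
    proof -
      have "letter (g \<otimes>\<^bsub>G\<^esub> h) * letter (inv\<^bsub>G\<^esub> h) \<in> twisted_relations G \<sigma>"
        unfolding twisted_relations_def using g h that by blast
      then show ?thesis using gh by (simp add: mult zero twisted_coset_zero)
    qed
    show "bracket G \<sigma> (inv\<^bsub>G\<^esub> g) \<otimes>\<^bsub>?A\<^esub> bracket G \<sigma> g \<otimes>\<^bsub>?A\<^esub> bracket G \<sigma> h
      = \<sigma> g h \<odot>\<^bsub>?A\<^esub> (bracket G \<sigma> (inv\<^bsub>G\<^esub> g) \<otimes>\<^bsub>?A\<^esub> bracket G \<sigma> (g \<otimes>\<^bsub>G\<^esub> h))"
    proof -
      have "letter (inv\<^bsub>G\<^esub> g) * letter g * letter h -
          \<sigma> g h \<odot>\<^bsub>free_algebra G\<^esub> (letter (inv\<^bsub>G\<^esub> g) * letter (g \<otimes>\<^bsub>G\<^esub> h)) \<in> twisted_relations G \<sigma>"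
        unfolding twisted_relations_def using g h by blast
      from twisted_coset_eq[OF this] show ?thesis
        unfolding mult3[OF gh(3,1,2)] mult[OF gh(3,5)] coset(4)[OF LL[OF gh(3,5)]]
        using F.smult_closed[OF LL[OF gh(3,5)]] by blast
    qed
    show "bracket G \<sigma> g \<otimes>\<^bsub>?A\<^esub> bracket G \<sigma> h \<otimes>\<^bsub>?A\<^esub> bracket G \<sigma> (inv\<^bsub>G\<^esub> h)
      = \<sigma> g h \<odot>\<^bsub>?A\<^esub> (bracket G \<sigma> (g \<otimes>\<^bsub>G\<^esub> h) \<otimes>\<^bsub>?A\<^esub> bracket G \<sigma> (inv\<^bsub>G\<^esub> h))"
    proof -
      have "letter g * letter h * letter (inv\<^bsub>G\<^esub> h) -
          \<sigma> g h \<odot>\<^bsub>free_algebra G\<^esub> (letter (g \<otimes>\<^bsub>G\<^esub> h) * letter (inv\<^bsub>G\<^esub> h)) \<in> twisted_relations G \<sigma>"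
        unfolding twisted_relations_def using g h by blast
      from twisted_coset_eq[OF this] show ?thesis
        unfolding mult3[OF gh(1,2,4)] mult[OF gh(5,4)] coset(4)[OF LL[OF gh(5,4)]]
        using F.smult_closed[OF LL[OF gh(5,4)]] by blast
    qed
  next
    have "letter ` carrier G \<subseteq> carrier (free_algebra G :: ('k, _) module)" using L by auto
    from F.quotient_algebra_generated[OF twisted_ideal_ideal this free_algebra_generated]
    show "generated_subalgebra ?A (bracket G \<sigma> ` carrier G) = carrier ?A"
      by (simp add: twisted_par_algebra_def bracket_def image_image)
  qed
qed

text \<open>The trace on the spectrum of the preimage, under the projection to coordinate
  \<open>c\<close>, of the complement of 0, which is open as the field is discrete.\<close>

lemma nonvanishing_openin:
  assumes "c \<in> B_alg G \<sigma>"
  shows "openin (B_hat_topology G \<sigma>) {f \<in> B_hat G \<sigma>. f c \<noteq> 0}"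
proof -
  let ?X = "product_topology (\<lambda>_. discrete_topology UNIV) (B_alg G \<sigma>) :: (_ \<Rightarrow> 'k) topology"
  have "openin ?X {f \<in> topspace ?X. f c \<in> - {0}}"
    by (rule openin_continuous_map_preimage[OF continuous_map_product_projection[OF assms]]) simp
  moreover have "{f \<in> B_hat G \<sigma>. f c \<noteq> 0} = {f \<in> topspace ?X. f c \<in> - {0}} \<inter> B_hat G \<sigma>"
    by (auto simp: B_hat_def characters_def PiE_def)
  ultimately show ?thesis
    unfolding B_hat_topology_def openin_subtopology by blast
qed

text \<open>A non-empty open set is not contained in a set with empty interior; here the open set
  consists of the characters not vanishing at \<open>c\<close>.\<close>

lemma topologically_free_moves:
  assumes "topologically_free G (B_hat_topology G \<sigma>) (hat_dom G \<sigma>) (hat_theta G \<sigma>)"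
    and "g \<in> carrier G" "g \<noteq> \<one>\<^bsub>G\<^esub>" "c \<in> B_alg G \<sigma>" "f\<^sub>0 \<in> B_hat G \<sigma>" "f\<^sub>0 c \<noteq> 0"
  obtains f where "f \<in> B_hat G \<sigma>" "f c \<noteq> 0"
    "f (idem G \<sigma> (inv\<^bsub>G\<^esub> g)) \<noteq> 1 \<or> hat_theta G \<sigma> g f \<noteq> f"
proof -
  let ?U = "{f \<in> B_hat G \<sigma>. f c \<noteq> 0}"
  let ?Fix = "{f \<in> hat_dom G \<sigma> (inv\<^bsub>G\<^esub> g). hat_theta G \<sigma> g f = f}"
  have "B_hat_topology G \<sigma> interior_of ?Fix = {}"
    using assms by (auto simp: topologically_free_def)
  then have "\<not> ?U \<subseteq> ?Fix"
    using interior_of_maximal[OF _ nonvanishing_openin[OF assms(4)]] assms(5,6) by blast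
  then show thesis using that by (auto simp: hat_dom_def)
qed

end

theorem corollary8p4:
  fixes G :: "('g, 'm) monoid_scheme"
    and \<sigma> :: "'g \<Rightarrow> 'g \<Rightarrow> 'k::field"
    and I :: "('g list \<Rightarrow>\<^sub>0 'k) set set"
  assumes "group G"
    and "\<sigma> \<in> pm TYPE('r) G"
    and "topologically_free G (B_hat_topology G \<sigma>) (hat_dom G \<sigma>) (hat_theta G \<sigma>)"
    and "ideal I (twisted_par_algebra G \<sigma>)"
    and "I \<noteq> {\<zero>\<^bsub>twisted_par_algebra G \<sigma>\<^esub>}"
  shows "I \<inter> B_alg G \<sigma> \<noteq> {\<zero>\<^bsub>twisted_par_algebra G \<sigma>\<^esub>}"
proof -
  let ?A = "twisted_par_algebra G \<sigma>"
  interpret P: twisted_partial_rep ?A G \<sigma> "bracket G \<sigma>"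
    by (rule twisted_par_algebra_twisted_partial_rep[OF assms(1)])
  interpret I: ideal I ?A by (rule assms(4))
  have e: "P.e = idem G \<sigma>"
    by (simp add: fun_eq_iff P.e_def idem_def Let_def)
  have B: "P.B = B_alg G \<sigma>"
    by (simp add: P.B_def B_alg_def e)
  have \<theta>: "P.\<theta> = theta G \<sigma>"
    by (simp add: fun_eq_iff P.\<theta>_def theta_def Let_def)
  have moved: "\<exists>f\<in>characters ?A P.B. f c \<noteq> 0 \<and> (f (P.e (inv\<^bsub>G\<^esub> g)) \<noteq> 1 \<or>
      (\<exists>w\<in>P.B. f (P.\<theta> (inv\<^bsub>G\<^esub> g) (P.e g \<otimes>\<^bsub>?A\<^esub> w)) \<noteq> f w))"
    if "g \<in> carrier G" "g \<noteq> \<one>\<^bsub>G\<^esub>" "c \<in> P.B" "\<exists>f\<in>characters ?A P.B. f c \<noteq> 0" for g c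
  proof -
    from that obtain f where f: "f \<in> B_hat G \<sigma>" "f c \<noteq> 0"
      "f (idem G \<sigma> (inv\<^bsub>G\<^esub> g)) \<noteq> 1 \<or> hat_theta G \<sigma> g f \<noteq> f"
      unfolding B B_hat_def[symmetric] using topologically_free_moves[OF assms(1,3)] by blast
    \<comment> \<open>Both functions are extensional on \<open>B_alg\<close>, so a character that is
      not fixed differs from its image at an element of \<open>B_alg\<close>.\<close>
    have "hat_theta G \<sigma> g f = f"
      if "\<forall>w\<in>B_alg G \<sigma>. f (theta G \<sigma> (inv\<^bsub>G\<^esub> g) (idem G \<sigma> g \<otimes>\<^bsub>?A\<^esub> w)) = f w"
      using that f(1) unfolding hat_theta_def
      by (intro extensionalityI[of _ "B_alg G \<sigma>"]) (auto simp: B_hat_def characters_def)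
    with f show ?thesis
      unfolding e B \<theta> B_hat_def[symmetric] by blast
  qed
  obtain x where "x \<in> I" "x \<noteq> \<zero>\<^bsub>?A\<^esub>"
    using assms(5) I.zero_closed by blast
  then show ?thesis
    using P.ideal_meets_B[OF moved assms(4)] by (auto simp: B)
qed

end
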